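(* Let $\mu,\nu>0$ be fixed, let $\rho=\nu/\mu$, and for each integer $N\ge 1$ let $H_N$ be the height of the birth-and-death process on $\{0,1,\dots,N\}$ with parameters $\mu,\nu$. Let $f(\rho)=\alpha(\rho)$ if $0<\rho<1$, where $\alpha(\rho)$ is the unique solution $x\in(0,1)$ of the equation $x^{x}(1-x)^{1-x}=\rho^{x}$, and let $f(\rho)=1$ if $\rho\ge 1$. Then $$\lim_{N\to\infty}\frac{\mathrm{Var}(H_N)}{N}=\frac{f(\rho)^2}{\rho},$$ and $$\lim_{N\to\infty}\frac{H_N}{N}=f(\rho)\quad\text{in probability},$$ that is, for every $\varepsilon>0$, $\lim_{N\to\infty}\mathbb{P}\left(\left|\frac{H_N}{N}-f(\rho)\right|\ge\varepsilon\right)=0$.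
   Context: For $\mu,\nu>0$ and an integer $N\ge1$, let $\{X_t:t\ge0\}$ be the continuous-time birth-and-death Markov chain on $E=\{0,1,\dots,N\}$ with conservative $Q$-matrix (row sums zero) whose off-diagonal entries are $q_{k,k+1}=(N-k)\nu$ for $0\le k\le N-1$, $q_{k,k-1}=k\mu$ for $1\le k\le N$, and $0$ otherwise. Its jump chain moves from $0$ to $1$ and from $N$ to $N-1$ with probability $1$, and for $1\le k\le N-1$ moves from $k$ to $k-1$ with probability $\frac{k}{k+(N-k)\rho}$ and from $k$ to $k+1$ with probability $\frac{(N-k)\rho}{k+(N-k)\rho}$, where $\rho=\nu/\mu$. Height: write $\{t:X_t>0\}=\bigcup_{i\ge1}[\tau_i,\eta_i)$ as the union of the maximal disjoint time intervals on which $X_t>0$, with $X_{\tau_i}=1$ and $X_{\eta_i}=0$, and set $H_N^{(i)}=\max\{X_t:t\in[\tau_i,\eta_i)\}$. The $H_N^{(i)}$ are independent and identically distributed, and $H_N$ denotes a random variable with their common distribution. Equivalently, $H_N$ is distributed as the maximal value reached by the chain started from $1$ before it first hits $0$; it takes values in $\{1,\dots,N\}$. *)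

theory Defs
  imports "HOL-Probability.Probability" "HOL-Real_Asymp.Real_Asymp"
begin

section \<open>Continuous-time Markov chains with a given Q-matrix\<close>

definition jump_prob :: "('s \<Rightarrow> 's \<Rightarrow> real) \<Rightarrow> 's \<Rightarrow> 's \<Rightarrow> real" where
  "jump_prob Q i j = (if i = j then 0 else Q i j / (- Q i i))"

text \<open>
  The jump chain / holding time definition of a continuous-time Markov chain, for a conservative
  Q-matrix \<open>Q\<close> on a finite state space \<open>E\<close> without absorbing states:
  \<open>X\<close> is a step process that visits the states \<open>Y 0, Y 1, \<dots>\<close> and stays in \<open>Y n\<close> for time \<open>S n\<close>,
  where \<open>Y\<close> is a discrete-time Markov chain with transition matrix \<open>jump_prob Q\<close> and,
  conditionally on \<open>Y\<close>, the \<open>S n\<close> are independent and exponential with rates \<open>- Q (Y n) (Y n)\<close>.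
  The initial distribution is arbitrary. As \<open>E\<close> is finite, the rates are bounded, so the jump
  times \<open>S 0 + \<dots> + S (n-1)\<close> almost surely tend to infinity and the last condition describes
  \<open>X t\<close> for all \<open>t \<ge> 0\<close>. Values of \<open>X t\<close> for \<open>t < 0\<close> are irrelevant.
\<close>
definition markov_chain ::
    "'a measure \<Rightarrow> 's set \<Rightarrow> ('s \<Rightarrow> 's \<Rightarrow> real) \<Rightarrow> (real \<Rightarrow> 'a \<Rightarrow> 's) \<Rightarrow> bool" where
  "markov_chain M E Q X \<longleftrightarrow>
     prob_space M \<and>
     (\<forall>t\<ge>0. X t \<in> measurable M (count_space E)) \<and>
     (\<exists>(Y :: nat \<Rightarrow> 'a \<Rightarrow> 's) (S :: nat \<Rightarrow> 'a \<Rightarrow> real).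
        (\<forall>n. Y n \<in> measurable M (count_space E)) \<and>
        (\<forall>n. S n \<in> borel_measurable M) \<and>
        (\<forall>n y s. (\<forall>k\<le>n. y k \<in> E \<and> 0 \<le> s k) \<longrightarrow>
           measure M {\<omega> \<in> space M. \<forall>k\<le>n. Y k \<omega> = y k \<and> S k \<omega> > s k} =
             measure M {\<omega> \<in> space M. Y 0 \<omega> = y 0} *
             (\<Prod>k<n. jump_prob Q (y k) (y (Suc k))) *
             (\<Prod>k\<le>n. exp (- ((- Q (y k) (y k)) * s k)))) \<and>
        (AE \<omega> in M. \<forall>n t. (\<Sum>k<n. S k \<omega>) \<le> t \<and> t < (\<Sum>k<Suc n. S k \<omega>) \<longrightarrow> X t \<omega> = Y n \<omega>))"

section \<open>The birth-and-death chain\<close>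

definition bd_offdiag :: "real \<Rightarrow> real \<Rightarrow> nat \<Rightarrow> nat \<Rightarrow> nat \<Rightarrow> real" where
  "bd_offdiag \<mu> \<nu> N i j =
     (if j = i + 1 \<and> j \<le> N then (real N - real i) * \<nu>
      else if i = j + 1 \<and> i \<le> N then real i * \<mu>
      else 0)"

definition bd_Q :: "real \<Rightarrow> real \<Rightarrow> nat \<Rightarrow> nat \<Rightarrow> nat \<Rightarrow> real" where
  "bd_Q \<mu> \<nu> N i j =
     (if i = j then - (\<Sum>k\<in>{0..N} - {i}. bd_offdiag \<mu> \<nu> N i k) else bd_offdiag \<mu> \<nu> N i j)"

section \<open>Excursions away from 0 and their heights\<close>

text \<open>
  The maximal intervals on which the path \<open>x\<close> (a right-continuous step function on \<open>{0..}\<close>) is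
  positive, \<open>{exc_start x i..<exc_end x i}\<close>, are listed in temporal order, starting with index
  \<open>0\<close>. For the chain all the infima are almost surely taken over nonempty sets.
\<close>
fun exc_start :: "(real \<Rightarrow> nat) \<Rightarrow> nat \<Rightarrow> real" and exc_end :: "(real \<Rightarrow> nat) \<Rightarrow> nat \<Rightarrow> real" where
  "exc_start x 0 = Inf {t. 0 \<le> t \<and> x t > 0}"
| "exc_start x (Suc i) = Inf {t. exc_end x i \<le> t \<and> x t > 0}"
| "exc_end x i = Inf {t. exc_start x i \<le> t \<and> x t = 0}"

definition exc_height :: "(real \<Rightarrow> nat) \<Rightarrow> nat \<Rightarrow> nat" where
  "exc_height x i = Max (x ` {exc_start x i..<exc_end x i})"

section \<open>The limit constant\<close>

definition alpha :: "real \<Rightarrow> real" where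
  "alpha \<rho> = (THE x. 0 < x \<and> x < 1 \<and> x powr x * (1 - x) powr (1 - x) = \<rho> powr x)"

definition height_limit :: "real \<Rightarrow> real" where
  "height_limit \<rho> = (if \<rho> < 1 then alpha \<rho> else 1)"

lemma alpha_ex1:
  fixes \<rho> :: real
  assumes "0 < \<rho>" "\<rho> < 1"
  shows "\<exists>!x. 0 < x \<and> x < 1 \<and> x powr x * (1 - x) powr (1 - x) = \<rho> powr x"
proof -
  define k where "k = (\<lambda>x::real. ln x + (1 - x) / x * ln (1 - x) - ln \<rho>)"
  have iff: "x powr x * (1 - x) powr (1 - x) = \<rho> powr x \<longleftrightarrow> k x = 0" if "0 < x" "x < 1" for x
  proof -
    have "x powr x * (1 - x) powr (1 - x) = exp (x * ln x + (1 - x) * ln (1 - x))"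
      using that by (simp add: powr_def exp_add)
    moreover have "\<rho> powr x = exp (x * ln \<rho>)"
      using assms by (simp add: powr_def)
    ultimately have "x powr x * (1 - x) powr (1 - x) = \<rho> powr x \<longleftrightarrow>
        x * ln x + (1 - x) * ln (1 - x) = x * ln \<rho>"
      by simp
    also have "\<dots> \<longleftrightarrow> k x = 0"
      using that by (auto simp: k_def field_simps)
    finally show ?thesis .
  qed
  have deriv: "(k has_real_derivative - ln (1 - x) / x\<^sup>2) (at x)" if "0 < x" "x < 1" for x
  proof -
    have "(k has_real_derivative
        1 / x + (((0 - 1) * x - (1 - x) * 1) / (x * x) * ln (1 - x)
          + (0 - 1) / (1 - x) * ((1 - x) / x)) - 0) (at x)"
      unfolding k_def using that
      by (intro DERIV_diff DERIV_add DERIV_mult DERIV_divide DERIV_const DERIV_ident)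
         (auto intro!: derivative_eq_intros)
    moreover have "1 / x + (((0 - 1) * x - (1 - x) * 1) / (x * x) * ln (1 - x)
          + (0 - 1) / (1 - x) * ((1 - x) / x)) - 0 = - ln (1 - x) / x\<^sup>2"
      using that by (simp add: power2_eq_square)
    ultimately show ?thesis by simp
  qed
  have mono: "k x < k y" if "0 < x" "x < y" "y < 1" for x y
  proof (rule DERIV_pos_imp_increasing[OF \<open>x < y\<close>])
    fix z assume "x \<le> z" "z \<le> y"
    with that have z: "0 < z" "z < 1" by auto
    have "0 < - ln (1 - z) / z\<^sup>2" using z by (auto intro!: divide_neg_pos)
    with deriv[OF z] show "\<exists>y. (k has_real_derivative y) (at z) \<and> 0 < y" by blast
  qed
  have neg: "k \<rho> < 0"
    using assms by (simp add: k_def divide_neg_pos mult_pos_neg)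
  have lim: "(k \<longlongrightarrow> - ln \<rho>) (at_left 1)"
    unfolding k_def by real_asymp
  have "- ln \<rho> > 0" using assms by simp
  with lim have "eventually (\<lambda>x. k x > 0) (at_left 1)"
    by (rule order_tendstoD)
  moreover have "eventually (\<lambda>x::real. x \<in> {\<rho><..<1}) (at_left 1)"
    using assms by (intro eventually_at_left_real) auto
  ultimately have "eventually (\<lambda>x. k x > 0 \<and> x \<in> {\<rho><..<1}) (at_left 1)"
    by eventually_elim auto
  then obtain b where b: "k b > 0" "\<rho> < b" "b < 1"
    by (auto dest!: eventually_happens)
  have "\<exists>x. \<rho> \<le> x \<and> x \<le> b \<and> k x = 0"
  proof (rule IVT)
    show "\<forall>x. \<rho> \<le> x \<and> x \<le> b \<longrightarrow> isCont k x"
      using b assms by (auto intro!: DERIV_isCont deriv)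
  qed (use b neg in auto)
  then obtain x where x: "\<rho> \<le> x" "x \<le> b" "k x = 0" by blast
  show ?thesis
  proof (rule ex1I[of _ x])
    show "0 < x \<and> x < 1 \<and> x powr x * (1 - x) powr (1 - x) = \<rho> powr x"
      using x b assms iff[of x] by auto
  next
    fix y assume "0 < y \<and> y < 1 \<and> y powr y * (1 - y) powr (1 - y) = \<rho> powr y"
    with iff[of y] have y: "0 < y" "y < 1" "k y = 0" by auto
    with mono[of x y] mono[of y x] x b assms show "y = x"
      by (cases x y rule: linorder_cases) auto
  qed
qed

end

theory Submission
  imports Defs
begin

text \<open>
  The height of an excursion only depends on the jump chain, and gambler's ruin gives
  \<open>P (H \<ge> m) = 1 / (\<Sum>k<m. 1 / (((N - 1) choose k) * \<rho> ^ k))\<close> for \<open>1 \<le> m \<le> N\<close>. Hence \<open>H = 1\<close> has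
  probability \<open>1 / ((N - 1) * \<rho> + 1)\<close>. With \<open>f\<close> the limit constant, the weight
  \<open>((N - 1) choose k) * \<rho> ^ k\<close> is large for \<open>3 \<le> k \<le> f * N - \<delta> * sqrt N\<close>; if \<open>\<rho> < 1\<close>, it is
  small at \<open>f * N + \<delta> * sqrt N\<close>. So up to an event of probability \<open>o(1 / N)\<close>, either \<open>H = 1\<close> or
  \<open>H\<close> is within \<open>\<delta> * sqrt N\<close> of \<open>f * N\<close>. The rare event \<open>H = 1\<close> alone contributes
  \<open>(f * N)\<^sup>2 / (N * \<rho>)\<close> to the variance, which is its leading term.
\<close>

section \<open>Excursions of a step path\<close>

text \<open>With \<open>x = k / n\<close>, the weight \<open>(n choose k) * \<rho> ^ k\<close>
  equals \<open>exp (- (k * entropy_rate \<rho> x))\<close> up to a factor between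
  \<open>1 / (n + 1)\<close> and 1. For \<rho> < 1 the rate vanishes exactly at
  \<open>alpha \<rho>\<close>, which is where the weights drop from huge to tiny; for \<rho> at
  least 1 no weight is below 1, so nothing stops the chain before N. The window has width
  \<open>\<delta> * sqrt N\<close> because a deviation of that size costs
  \<open>\<delta>\<^sup>2 * N\<close> in the second moment, a small fraction of N once \<delta> is
  small. Outside the window only the bound N on the deviation is available, hence the required
  \<open>o(1 / N)\<close>. At the edge of the window the exponent has order \<open>sqrt N\<close>,
  which beats every power of N. Moments are taken about \<open>f * N\<close>, not about the mean;
  the mean lies within \<open>o(sqrt N)\<close> of it, so the squared offset vanishes in the limit.
  On the probabilistic side, conditional expectations are finite sums over the next state, and the
  i-th excursion is followed from time 0 by one bounded martingale, which replaces a restart of the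
  chain at the beginning of the excursion.\<close>

lemma step_path_value:
  fixes x :: "real \<Rightarrow> nat" and T :: "nat \<Rightarrow> real"
  assumes T: "strict_mono T"
    and x: "\<forall>n t. T n \<le> t \<and> t < T (Suc n) \<longrightarrow> x t = y n"
    and "T a \<le> t" "t < T b"
  shows "\<exists>k. a \<le> k \<and> k < b \<and> x t = y k"
  using \<open>t < T b\<close>
proof (induction b)
  case 0
  then show ?case using \<open>T a \<le> t\<close> strict_mono_leD[OF T, of 0 a] by simp
next
  case (Suc b)
  show ?case
  proof (cases "t < T b")
    case True
    then show ?thesis using Suc.IH less_Suc_eq by blast
  next
    case False
    then have "x t = y b" using x Suc.prems by simp
    moreover have "T a < T (Suc b)" using \<open>T a \<le> t\<close> Suc.prems by linarith
    then have "a \<le> b" using T by (simp add: strict_mono_less)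
    ultimately show ?thesis by blast
  qed
qed

text \<open>The infimum is attained because the steps are closed on the left. The predicate
  \<open>P\<close> is generic since starts of excursions look for a positive value and ends for the
  value 0.\<close>

lemma Inf_step_path:
  fixes x :: "real \<Rightarrow> nat" and T :: "nat \<Rightarrow> real"
  assumes T: "strict_mono T"
    and x: "\<forall>n t. T n \<le> t \<and> t < T (Suc n) \<longrightarrow> x t = y n"
    and "a \<le> b" "P (y b)" "\<And>k. a \<le> k \<Longrightarrow> k < b \<Longrightarrow> \<not> P (y k)"
  shows "Inf {t. T a \<le> t \<and> P (x t)} = T b"
proof (rule cInf_eq_minimum)
  have "T b < T (Suc b)" using T by (simp add: strict_mono_Suc_iff)
  then have "x (T b) = y b" using x by simp
  then show "T b \<in> {t. T a \<le> t \<and> P (x t)}"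
    using \<open>P (y b)\<close> strict_mono_leD[OF T \<open>a \<le> b\<close>] by simp
next
  fix t assume t: "t \<in> {t. T a \<le> t \<and> P (x t)}"
  then show "T b \<le> t"
    using step_path_value[OF T x, of a t b] assms(5) by fastforce
qed

lemma image_step_path:
  fixes x :: "real \<Rightarrow> nat" and T :: "nat \<Rightarrow> real"
  assumes T: "strict_mono T"
    and x: "\<forall>n t. T n \<le> t \<and> t < T (Suc n) \<longrightarrow> x t = y n"
  shows "x ` {T a..<T b} = y ` {a..<b}"
proof (intro equalityI subsetI)
  fix v assume "v \<in> x ` {T a..<T b}"
  then obtain t where "T a \<le> t" "t < T b" "v = x t" by auto
  then show "v \<in> y ` {a..<b}"
    using step_path_value[OF T x, of a t b] by auto
next
  fix v assume "v \<in> y ` {a..<b}"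
  then obtain k where k: "a \<le> k" "k < b" "v = y k" by auto
  have "T k < T (Suc k)" using T by (simp add: strict_mono_Suc_iff)
  then have "x (T k) = y k" using x by simp
  moreover have "T a \<le> T k" "T k < T b" using k T
    by (auto simp: strict_mono_less_eq strict_mono_less)
  ultimately show "v \<in> x ` {T a..<T b}" using k by (force simp: image_iff)
qed

text \<open>This counter labels each step with the excursion it belongs to. It looks only at the
  past of the step, which makes it usable in a martingale argument.\<close>

definition zeros_upto :: "(nat \<Rightarrow> nat) \<Rightarrow> nat \<Rightarrow> nat" where
  "zeros_upto y n = card {k. k \<le> n \<and> y k = 0}"

lemma zeros_upto_Suc: "zeros_upto y (Suc n) = zeros_upto y n + (if y (Suc n) = 0 then 1 else 0)"
proof -
  have "{k. k \<le> Suc n \<and> y k = 0} =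
      (if y (Suc n) = 0 then insert (Suc n) else id) {k. k \<le> n \<and> y k = 0}"
    by (auto simp: le_Suc_eq)
  then show ?thesis by (simp add: zeros_upto_def)
qed

text \<open>The number of zeros that precede excursion \<open>i\<close>: a path that begins at 0 has
  one zero before its excursion 0, any other path has none.\<close>

definition exc_index :: "(nat \<Rightarrow> nat) \<Rightarrow> nat \<Rightarrow> nat" where
  "exc_index y i = i + (if y 0 = 0 then 1 else 0)"

text \<open>Links the counter to the positions of the zeros, in terms of which the infima are
  computed. A zero counts itself, so it opens the block of its label; block 0 has no opening
  zero.\<close>

lemma zeros_upto_eq_iff:
  assumes inf: "infinite {k. y k = 0}"
  shows "zeros_upto y k = r \<longleftrightarrow>
    (r = 0 \<or> enumerate {k. y k = 0} (r - 1) \<le> k) \<and> k < enumerate {k. y k = 0} r"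
proof -
  let ?A = "{k. y k = 0}"
  let ?e = "enumerate ?A"
  have sm: "strict_mono (?e)" using inf by (simp add: strict_mono_enumerate)
  have ran: "range (?e) = ?A" using inf by (rule range_enumerate)
  have key: "zeros_upto y k = r" if "r = 0 \<or> ?e (r - 1) \<le> k" "k < ?e r" for r
  proof -
    have "{j. j \<le> k \<and> y j = 0} = ?e ` {..<r}"
    proof (intro equalityI subsetI)
      fix j assume j: "j \<in> {j. j \<le> k \<and> y j = 0}"
      then obtain q where q: "j = ?e q" using ran by auto
      then have "q < r" using j that(2) strict_mono_less[OF sm, of q r] by simp
      then show "j \<in> ?e ` {..<r}" using q by auto
    next
      fix j assume "j \<in> ?e ` {..<r}"
      then obtain q where q: "j = ?e q" "q < r" by auto
      then have "j \<le> ?e (r - 1)" using q by (simp add: strict_mono_less_eq[OF sm])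
      moreover have "j \<in> ?A" using q enumerate_in_set[OF inf, of q] by simp
      ultimately show "j \<in> {j. j \<le> k \<and> y j = 0}" using that q by auto
    qed
    then show ?thesis
      by (simp add: zeros_upto_def card_image inj_on_def strict_mono_eq[OF sm])
  qed
  \<comment> \<open>The blocks between successive zeros cover all indices, so \<open>k\<close> lies
    in some block \<open>q\<close>; \<open>key\<close> then determines its label, which gives both
    directions.\<close>
  define q where "q = (LEAST q. k < ?e q)"
  have "k \<le> ?e k" using sm by (rule strict_mono_imp_increasing)
  also have "\<dots> < ?e (Suc k)" using sm by (simp add: strict_mono_Suc_iff)
  finally have q1: "k < ?e q" unfolding q_def by (rule LeastI)
  have q2: "q = 0 \<or> ?e (q - 1) \<le> k"
    using not_less_Least[of "q - 1" "\<lambda>q. k < ?e q"] q_def by (cases q) auto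
  have z: "zeros_upto y k = q" by (rule key[OF q2 q1])
  show ?thesis
  proof
    assume "zeros_upto y k = r"
    then have "r = q" using z by simp
    then show "(r = 0 \<or> ?e (r - 1) \<le> k) \<and> k < ?e r" using q1 q2 by simp
  next
    assume "(r = 0 \<or> ?e (r - 1) \<le> k) \<and> k < ?e r"
    then show "zeros_upto y k = r" by (elim conjE) (rule key)
  qed
qed

text \<open>By \<open>pos\<close> a zero is left at the next jump, so an excursion starts one index
  after the zero before it and ends at the next zero.\<close>

lemma exc_start_end:
  fixes x :: "real \<Rightarrow> nat" and T :: "nat \<Rightarrow> real"
  assumes T: "strict_mono T" "T 0 = 0"
    and x: "\<forall>n t. T n \<le> t \<and> t < T (Suc n) \<longrightarrow> x t = y n"
    and inf: "infinite {k. y k = 0}"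
    and pos: "\<forall>k. y k = 0 \<longrightarrow> y (Suc k) > 0"
  shows "exc_start x i = T (let r = exc_index y i in
      if r = 0 then 0 else Suc (enumerate {k. y k = 0} (r - 1)))"
    and "exc_end x i = T (enumerate {k. y k = 0} (exc_index y i))"
proof -
  let ?e = "enumerate {k. y k = 0}"
  let ?s = "\<lambda>i. let r = exc_index y i in if r = 0 then 0 else Suc (?e (r - 1))"
  have e0: "y (?e r) = 0" for r using enumerate_in_set[OF inf] by simp
  have sm: "strict_mono ?e" using inf by (simp add: strict_mono_enumerate)
  \<comment> \<open>Starts and ends are defined by mutual recursion. Proving the end from the start
    at the same index leaves a plain induction for the starts.\<close>
  have end_eq: "exc_end x i = T (?e (exc_index y i))" if "exc_start x i = T (?s i)" for i
  proof -
    have "Inf {t. T (?s i) \<le> t \<and> x t = 0} = T (?e (exc_index y i))"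
    proof (rule Inf_step_path[OF T(1) x])
      show "?s i \<le> ?e (exc_index y i)"
      proof (cases "exc_index y i")
        case (Suc r)
        then show ?thesis using sm by (simp add: Let_def Suc_le_eq strict_mono_less)
      qed simp
    next
      fix k assume k: "?s i \<le> k" "k < ?e (exc_index y i)"
      show "\<not> y k = 0"
      proof
        assume "y k = 0"
        then have "k \<in> range ?e" using range_enumerate[OF inf] by simp
        then obtain q where "k = ?e q" by blast
        then show False using k
          by (auto simp: Let_def Suc_le_eq strict_mono_less[OF sm] split: if_splits)
      qed
    qed (use e0 in auto)
    then show ?thesis using that by simp
  qed
  have start: "exc_start x i = T (?s i)" for i
  proof (induction i)
    case 0
    have "Inf {t. T 0 \<le> t \<and> 0 < x t} = T (?s 0)"
    proof (rule Inf_step_path[OF T(1) x])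
      \<comment> \<open>If the path begins at 0, that zero is the first one enumerated, so
        \<open>?s 0\<close> is index 1; otherwise \<open>?s 0\<close> is index 0.\<close>
      have *: "?e 0 = 0" if "y 0 = 0"
        using that by (simp add: enumerate_0 Least_equality)
      then show "0 < y (?s 0)" using pos[rule_format, of 0] by (auto simp: exc_index_def)
      fix k assume "0 \<le> k" "k < ?s 0"
      with * show "\<not> 0 < y k" by (auto simp: exc_index_def split: if_splits)
    qed auto
    then show ?case using T by simp
  next
    case (Suc i)
    have "Inf {t. T (?e (exc_index y i)) \<le> t \<and> 0 < x t} = T (Suc (?e (exc_index y i)))"
      using e0 pos[rule_format, of "?e (exc_index y i)"]
      by (intro Inf_step_path[OF T(1) x]) (auto simp: less_Suc_eq_le dest: le_antisym)
    moreover have "exc_index y (Suc i) = Suc (exc_index y i)" by (simp add: exc_index_def)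
    ultimately show ?case using end_eq[OF Suc] by (simp add: Let_def del: exc_end.simps)
  qed
  show "exc_start x i = T (?s i)" by (rule start)
  show "exc_end x i = T (?e (exc_index y i))" by (rule end_eq[OF start])
qed

text \<open>The jump times disappear here: the height becomes a functional of the jump chain. The
  condition \<open>y k > 0\<close> removes the zero that opens the block; finiteness and
  nonemptiness make \<open>Max\<close> meaningful.\<close>

lemma exc_height_eq:
  fixes x :: "real \<Rightarrow> nat" and T :: "nat \<Rightarrow> real"
  assumes T: "strict_mono T" "T 0 = 0"
    and x: "\<forall>n t. T n \<le> t \<and> t < T (Suc n) \<longrightarrow> x t = y n"
    and inf: "infinite {k. y k = 0}"
    and pos: "\<forall>k. y k = 0 \<longrightarrow> y (Suc k) > 0"
  shows "exc_height x i = Max (y ` {k. y k > 0 \<and> zeros_upto y k = exc_index y i})"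
    and "finite {k. y k > 0 \<and> zeros_upto y k = exc_index y i}"
    and "{k. y k > 0 \<and> zeros_upto y k = exc_index y i} \<noteq> {}"
proof -
  let ?e = "enumerate {k. y k = 0}"
  let ?s = "let r = exc_index y i in if r = 0 then 0 else Suc (?e (r - 1))"
  let ?A = "{k. y k > 0 \<and> zeros_upto y k = exc_index y i}"
  have sm: "strict_mono ?e" using inf by (simp add: strict_mono_enumerate)
  have e0: "y (?e r) = 0" for r using enumerate_in_set[OF inf] by simp
  have ran: "range ?e = {k. y k = 0}" by (rule range_enumerate[OF inf])
  have A: "?A = {?s..<?e (exc_index y i)}"
  proof (intro equalityI subsetI)
    fix k assume "k \<in> ?A"
    then show "k \<in> {?s..<?e (exc_index y i)}"
      using e0[of "exc_index y i - 1"]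
      by (auto simp: zeros_upto_eq_iff[OF inf] Let_def Suc_le_eq order.order_iff_strict)
  next
    fix k assume k: "k \<in> {?s..<?e (exc_index y i)}"
    have "y k \<noteq> 0"
    proof
      assume "y k = 0"
      then have "k \<in> range ?e" using ran by simp
      then obtain q where "k = ?e q" by blast
      then show False using k
        by (auto simp: Let_def Suc_le_eq strict_mono_less[OF sm] split: if_splits)
    qed
    then show "k \<in> ?A" using k
      by (auto simp: zeros_upto_eq_iff[OF inf] Let_def split: if_splits)
  qed
  have exc_end_eq: "exc_end x i = T (?e (exc_index y i))"
    by (rule exc_start_end(2)[OF assms])
  have exc_start_eq: "exc_start x i = T ?s"
    by (rule exc_start_end(1)[OF assms])
  show "exc_height x i = Max (y ` ?A)"
    unfolding exc_height_def A exc_start_eq exc_end_eq image_step_path[OF T(1) x] by simp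
  show "finite ?A" unfolding A by simp
  have "?s < ?e (exc_index y i)"
  proof (cases "exc_index y i")
    case 0
    then have "y 0 \<noteq> 0" by (auto simp: exc_index_def split: if_splits)
    then have "?e 0 \<noteq> 0" using e0[of 0] by metis
    then show ?thesis using 0 by simp
  next
    case (Suc r)
    \<comment> \<open>Successive zeros are not adjacent because of \<open>pos\<close>, so a positive
      step lies between them.\<close>
    have "?e r < ?e (Suc r)" by (simp add: strict_mono_less[OF sm])
    moreover have "Suc (?e r) \<noteq> ?e (Suc r)" using pos[rule_format, of "?e r"] e0[of r] e0[of "Suc r"] by auto
    ultimately show ?thesis using Suc by simp
  qed
  then show "?A \<noteq> {}" unfolding A by simp
qed

section \<open>Finite Markov chains\<close>

definition depends_upto :: "nat \<Rightarrow> ((nat \<Rightarrow> 's) \<Rightarrow> 'b) \<Rightarrow> bool" where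
  "depends_upto n f \<longleftrightarrow> (\<forall>y y'. (\<forall>k\<le>n. y k = y' k) \<longrightarrow> f y = f y')"

lemma depends_uptoD: "depends_upto n f \<Longrightarrow> (\<And>k. k \<le> n \<Longrightarrow> y k = y' k) \<Longrightarrow> f y = f y'"
  by (auto simp: depends_upto_def)

lemma depends_upto_fun_upd:
  assumes "depends_upto (Suc n) f"
  shows "depends_upto n (\<lambda>y. f (y(Suc n := j)))"
  unfolding depends_upto_def by (intro allI impI depends_uptoD[OF assms]) auto

lemma (in prob_space) integrable_scaled_indicator:
  "A \<in> sets M \<Longrightarrow> integrable M (\<lambda>\<omega>. c * indicat_real A \<omega>)"
  by (intro integrable_mult_right) (simp add: less_top[symmetric])

lemma (in prob_space) expectation_scaled_indicator:
  "A \<in> sets M \<Longrightarrow> expectation (\<lambda>\<omega>. c * indicat_real A \<omega>) = c * prob A"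
  by simp

lemma sets_eq_value:
  assumes "Y \<in> measurable M (count_space E)"
  shows "{\<omega> \<in> space M. Y \<omega> = y} \<in> sets M"
proof (cases "y \<in> E")
  case True
  have "Y -` {y} \<inter> space M \<in> sets M"
    by (rule measurable_sets[OF assms]) (use True in auto)
  then show ?thesis by (simp add: vimage_def Int_def conj_commute)
next
  case False
  then have "{\<omega> \<in> space M. Y \<omega> = y} = {}" using measurable_space[OF assms] by auto
  then show ?thesis by (metis sets.empty_sets)
qed

text \<open>The Markov property is a product identity for cylinder events, so histories of
  probability 0 need no special treatment and the initial law stays free.\<close>

locale finite_chain = prob_space M for M :: "'a measure" +
  fixes E :: "'s set" and p :: "'s \<Rightarrow> 's \<Rightarrow> real" and Y :: "nat \<Rightarrow> 'a \<Rightarrow> 's"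
  assumes finite_E: "finite E"
    and Y_meas: "Y n \<in> measurable M (count_space E)"
    and transition: "(\<And>k. k \<le> n \<Longrightarrow> y k \<in> E) \<Longrightarrow> j \<in> E \<Longrightarrow>
      prob {\<omega> \<in> space M. (\<forall>k\<le>n. Y k \<omega> = y k) \<and> Y (Suc n) \<omega> = j} =
      prob {\<omega> \<in> space M. \<forall>k\<le>n. Y k \<omega> = y k} * p (y n) j"
begin

abbreviation (input) Y_path :: "'a \<Rightarrow> nat \<Rightarrow> 's" where
  "Y_path \<omega> \<equiv> (\<lambda>k. Y k \<omega>)"

lemma Y_in_E: "\<omega> \<in> space M \<Longrightarrow> Y n \<omega> \<in> E"
  using measurable_space[OF Y_meas] by simp

lemma Y_eq_sets [measurable]: "{\<omega> \<in> space M. Y n \<omega> = y} \<in> sets M"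
  by (rule sets_eq_value[OF Y_meas])

lemma cyl_sets [measurable]: "{\<omega> \<in> space M. \<forall>k\<le>n. Y k \<omega> = y k} \<in> sets M"
  by measurable

lemma cyl_Suc_sets [measurable]:
  "{\<omega> \<in> space M. (\<forall>k\<le>n. Y k \<omega> = y k) \<and> Y (Suc n) \<omega> = j} \<in> sets M"
  by measurable

text \<open>On a finite state space a functional of finitely many steps is a finite combination of
  cylinder indicators. Measurability, integrability and expectations then follow by
  linearity.\<close>

lemma cyl_expansion:
  assumes f: "depends_upto n f" and \<omega>: "\<omega> \<in> space M"
  shows "f (Y_path \<omega>) = (\<Sum>y\<in>{..n} \<rightarrow>\<^sub>E E. f y * indicat_real {\<omega> \<in> space M. \<forall>k\<le>n. Y k \<omega> = y k} \<omega>)"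
proof -
  \<comment> \<open>\<open>PiE\<close> has exactly one representative of each finite path, undefined
    after \<open>n\<close>; \<open>restrict\<close> selects the one of \<omega>.\<close>
  let ?y = "restrict (Y_path \<omega>) {..n}"
  have "(\<Sum>y\<in>{..n} \<rightarrow>\<^sub>E E. f y * indicat_real {\<omega> \<in> space M. \<forall>k\<le>n. Y k \<omega> = y k} \<omega>) =
      (\<Sum>y\<in>{..n} \<rightarrow>\<^sub>E E. if y = ?y then f y else 0)"
  proof (rule sum.cong)
    fix y assume y: "y \<in> {..n} \<rightarrow>\<^sub>E E"
    have "(\<forall>k\<le>n. Y k \<omega> = y k) \<longleftrightarrow> y = ?y"
    proof
      assume *: "\<forall>k\<le>n. Y k \<omega> = y k"
      show "y = ?y"
      proof
        fix k show "y k = ?y k" using * PiE_arb[OF y, of k] by (cases "k \<le> n") auto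
      qed
    next
      assume *: "y = ?y"
      show "\<forall>k\<le>n. Y k \<omega> = y k"
      proof (intro allI impI)
        fix k assume "k \<le> n"
        with fun_cong[OF *, of k] show "Y k \<omega> = y k" by simp
      qed
    qed
    then show "f y * indicat_real {\<omega> \<in> space M. \<forall>k\<le>n. Y k \<omega> = y k} \<omega> = (if y = ?y then f y else 0)"
      using \<omega> by simp
  qed simp
  also have "\<dots> = f ?y"
    using finite_E Y_in_E[OF \<omega>] by (simp add: finite_PiE)
  also have "\<dots> = f (Y_path \<omega>)"
    by (rule depends_uptoD[OF f]) simp
  finally show ?thesis by simp
qed

lemma path_meas [measurable]:
  assumes f: "depends_upto n (f :: _ \<Rightarrow> real)"
  shows "(\<lambda>\<omega>. f (Y_path \<omega>)) \<in> borel_measurable M"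
  by (subst measurable_cong[OF cyl_expansion[OF f]]) measurable

lemma path_integrable:
  assumes f: "depends_upto n (f :: _ \<Rightarrow> real)"
  shows "integrable M (\<lambda>\<omega>. f (Y_path \<omega>))"
  by (subst Bochner_Integration.integrable_cong[OF refl cyl_expansion[OF f]], assumption)
     (intro Bochner_Integration.integrable_sum integrable_scaled_indicator cyl_sets)

lemma path_expectation:
  assumes f: "depends_upto n (f :: _ \<Rightarrow> real)"
  shows "expectation (\<lambda>\<omega>. f (Y_path \<omega>)) =
    (\<Sum>y\<in>{..n} \<rightarrow>\<^sub>E E. f y * prob {\<omega> \<in> space M. \<forall>k\<le>n. Y k \<omega> = y k})"
  by (subst Bochner_Integration.integral_cong[OF refl cyl_expansion[OF f]], assumption,
      subst Bochner_Integration.integral_sum)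
     (intro integrable_scaled_indicator cyl_sets sum.cong refl expectation_scaled_indicator)+

lemma expectation_step_indicator:
  assumes g: "depends_upto n (g :: _ \<Rightarrow> real)" and j: "j \<in> E"
  shows "expectation (\<lambda>\<omega>. g (Y_path \<omega>) * indicat_real {\<omega> \<in> space M. Y (Suc n) \<omega> = j} \<omega>) =
    expectation (\<lambda>\<omega>. p (Y n \<omega>) j * g (Y_path \<omega>))"
proof -
  have "expectation (\<lambda>\<omega>. g (Y_path \<omega>) * indicat_real {\<omega> \<in> space M. Y (Suc n) \<omega> = j} \<omega>) =
      expectation (\<lambda>\<omega>. \<Sum>y\<in>{..n} \<rightarrow>\<^sub>E E. g y *
        indicat_real {\<omega> \<in> space M. (\<forall>k\<le>n. Y k \<omega> = y k) \<and> Y (Suc n) \<omega> = j} \<omega>)"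
    by (rule Bochner_Integration.integral_cong[OF refl], subst cyl_expansion[OF g])
       (auto simp: sum_distrib_right indicator_def intro!: sum.cong)
  also have "\<dots> = (\<Sum>y\<in>{..n} \<rightarrow>\<^sub>E E. g y *
        prob {\<omega> \<in> space M. (\<forall>k\<le>n. Y k \<omega> = y k) \<and> Y (Suc n) \<omega> = j})"
    by (subst Bochner_Integration.integral_sum)
       (intro integrable_scaled_indicator cyl_Suc_sets sum.cong refl expectation_scaled_indicator)+
  also have "\<dots> = (\<Sum>y\<in>{..n} \<rightarrow>\<^sub>E E. (p (y n) j * g y) * prob {\<omega> \<in> space M. \<forall>k\<le>n. Y k \<omega> = y k})"
    by (intro sum.cong refl, subst transition) (use j in auto)
  also have "\<dots> = expectation (\<lambda>\<omega>. p (Y n \<omega>) j * g (Y_path \<omega>))"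
    by (rule path_expectation[symmetric, where f = "\<lambda>y. p (y n) j * g y"])
       (use g in \<open>auto simp: depends_upto_def\<close>)
  finally show ?thesis .
qed

text \<open>The tower property for one step: split by the value \<open>j\<close> of the next state,
  and replace the indicator of that value by its transition probability given the past.\<close>

lemma expectation_step:
  assumes f: "depends_upto (Suc n) (f :: _ \<Rightarrow> real)"
  shows "expectation (\<lambda>\<omega>. f (Y_path \<omega>)) =
    expectation (\<lambda>\<omega>. \<Sum>j\<in>E. p (Y n \<omega>) j * f ((Y_path \<omega>)(Suc n := j)))"
proof -
  have upd: "depends_upto n (\<lambda>y. f (y(Suc n := j)))" for j
    using f by (rule depends_upto_fun_upd)
  have upd': "depends_upto n (\<lambda>y. p (y n) j * f (y(Suc n := j)))" for j
    using upd[of j] by (auto simp: depends_upto_def)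
  have "expectation (\<lambda>\<omega>. f (Y_path \<omega>)) = expectation (\<lambda>\<omega>. \<Sum>j\<in>E. f ((Y_path \<omega>)(Suc n := j)) *
      indicat_real {\<omega> \<in> space M. Y (Suc n) \<omega> = j} \<omega>)"
  proof (rule Bochner_Integration.integral_cong[OF refl])
    fix \<omega> assume \<omega>: "\<omega> \<in> space M"
    have "(\<Sum>j\<in>E. f ((Y_path \<omega>)(Suc n := j)) * indicat_real {\<omega> \<in> space M. Y (Suc n) \<omega> = j} \<omega>) =
        (\<Sum>j\<in>E. if j = Y (Suc n) \<omega> then f ((Y_path \<omega>)(Suc n := j)) else 0)"
      using \<omega> by (intro sum.cong) auto
    also have "\<dots> = f ((Y_path \<omega>)(Suc n := Y (Suc n) \<omega>))"
      using Y_in_E[OF \<omega>] finite_E by simp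
    also have "(Y_path \<omega>)(Suc n := Y (Suc n) \<omega>) = Y_path \<omega>" by auto
    finally show "f (Y_path \<omega>) = (\<Sum>j\<in>E. f ((Y_path \<omega>)(Suc n := j)) *
        indicat_real {\<omega> \<in> space M. Y (Suc n) \<omega> = j} \<omega>)" by (rule sym)
  qed
  also have "\<dots> = (\<Sum>j\<in>E. expectation (\<lambda>\<omega>. f ((Y_path \<omega>)(Suc n := j)) *
      indicat_real {\<omega> \<in> space M. Y (Suc n) \<omega> = j} \<omega>))"
    by (rule Bochner_Integration.integral_sum)
       (auto intro!: integrable_real_mult_indicator path_integrable[OF upd])
  also have "\<dots> = (\<Sum>j\<in>E. expectation (\<lambda>\<omega>. p (Y n \<omega>) j * f ((Y_path \<omega>)(Suc n := j))))"
    by (intro sum.cong refl expectation_step_indicator[OF upd])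
  also have "\<dots> = expectation (\<lambda>\<omega>. \<Sum>j\<in>E. p (Y n \<omega>) j * f ((Y_path \<omega>)(Suc n := j)))"
    by (rule Bochner_Integration.integral_sum[symmetric]) (rule path_integrable[OF upd'])
  finally show ?thesis .
qed

lemma integrable_step:
  assumes f: "depends_upto (Suc n) (f :: _ \<Rightarrow> real)"
  shows "integrable M (\<lambda>\<omega>. \<Sum>j\<in>E. p (Y n \<omega>) j * f ((\<lambda>k. Y k \<omega>)(Suc n := j)))"
proof (rule Bochner_Integration.integrable_sum)
  fix j
  have "depends_upto n (\<lambda>y. p (y n) j * f (y(Suc n := j)))"
    using depends_upto_fun_upd[OF f, of j] by (auto simp: depends_upto_def)
  then show "integrable M (\<lambda>\<omega>. p (Y n \<omega>) j * f ((\<lambda>k. Y k \<omega>)(Suc n := j)))"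
    by (rule path_integrable)
qed

text \<open>The one-step formula, applied to the indicator of a forbidden transition, gives
  expectation 0.\<close>

lemma AE_transition:
  assumes "\<And>k j. P k j \<Longrightarrow> p k j = 0"
  shows "AE \<omega> in M. \<not> P (Y n \<omega>) (Y (Suc n) \<omega>)"
proof -
  let ?f = "\<lambda>y :: nat \<Rightarrow> 's. if P (y n) (y (Suc n)) then 1 else 0 :: real"
  have f: "depends_upto (Suc n) ?f" by (simp add: depends_upto_def)
  have "expectation (\<lambda>\<omega>. ?f (Y_path \<omega>)) =
      expectation (\<lambda>\<omega>. \<Sum>j\<in>E. p (Y n \<omega>) j * ?f ((Y_path \<omega>)(Suc n := j)))"
    by (rule expectation_step[OF f])
  also have "(\<lambda>\<omega>. \<Sum>j\<in>E. p (Y n \<omega>) j * ?f ((Y_path \<omega>)(Suc n := j))) = (\<lambda>_. 0)"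
    using assms by (auto simp: fun_eq_iff intro!: sum.neutral)
  finally have "expectation (\<lambda>\<omega>. ?f (Y_path \<omega>)) = 0" by simp
  then have "AE \<omega> in M. ?f (Y_path \<omega>) = 0"
    by (subst (asm) integral_nonneg_eq_0_iff_AE) (auto intro!: path_integrable[OF f])
  then show ?thesis by eventually_elim (auto split: if_splits)
qed

end

section \<open>Recurrence of the birth-and-death chain\<close>

lemma Suc_times_choose_Suc: "Suc k * (n choose Suc k) = (n - k) * (n choose k)"
  by (metis binomial_absorb_comp binomial_absorption mult.commute diff_Suc_Suc)

text \<open>The quotient is 0 at state 0 and, for \<open>N >= 1\<close>, equals 1 at state
  \<open>N\<close>, so the forced moves at both ends need no separate clauses.\<close>

definition bd_down :: "nat \<Rightarrow> real \<Rightarrow> nat \<Rightarrow> real" where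
  "bd_down N \<rho> k = real k / (real k + (real N - real k) * \<rho>)"

definition bd_jump :: "nat \<Rightarrow> real \<Rightarrow> nat \<Rightarrow> nat \<Rightarrow> real" where
  "bd_jump N \<rho> k j = (if j = Suc k then 1 - bd_down N \<rho> k else if k = Suc j then bd_down N \<rho> k else 0)"

text \<open>For \<open>k < N\<close> this is the product over \<open>j = 1, ..., k\<close> of the
  ratios down/up, \<open>j / ((N - j) * \<rho>)\<close>, in closed form. For \<open>k >= N\<close>
  the binomial is 0, and division by 0 makes the term 0.\<close>

definition ruin_term :: "nat \<Rightarrow> real \<Rightarrow> nat \<Rightarrow> real" where
  "ruin_term N \<rho> k = 1 / (real ((N - 1) choose k) * \<rho> ^ k)"

text \<open>The scale function of the chain, normalised by the values 0 at 0 and 1 at 1; the chance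
  to reach \<open>m\<close> from 1 before 0 is then its reciprocal at \<open>m\<close>.\<close>

definition ruin_sum :: "nat \<Rightarrow> real \<Rightarrow> nat \<Rightarrow> real" where
  "ruin_sum N \<rho> m = (\<Sum>k<m. ruin_term N \<rho> k)"

context
  fixes N :: nat and \<rho> :: real
  assumes N: "1 \<le> N" and \<rho>: "0 < \<rho>"
begin

lemma bd_denom_pos: "k \<le> N \<Longrightarrow> 0 < real k + (real N - real k) * \<rho>"
  using N \<rho> by (cases "k = 0") (auto intro: add_pos_nonneg)

lemma bd_down_0 [simp]: "bd_down N \<rho> 0 = 0"
  by (simp add: bd_down_def)

lemma bd_down_N [simp]: "bd_down N \<rho> N = 1"
  using N by (simp add: bd_down_def)

lemma bd_down_le_1: "k \<le> N \<Longrightarrow> bd_down N \<rho> k \<le> 1"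
  using bd_denom_pos[of k] \<rho> by (simp add: bd_down_def)

lemma bd_down_ge: "1 \<le> k \<Longrightarrow> k \<le> N \<Longrightarrow> 1 / (1 + real N * \<rho>) \<le> bd_down N \<rho> k"
proof -
  assume k: "1 \<le> k" "k \<le> N"
  have "real N * \<rho> * 1 \<le> real N * \<rho> * real k"
    using k \<rho> by (intro mult_left_mono) auto
  moreover have "0 \<le> real k * \<rho>" using \<rho> by simp
  ultimately have "real k + (real N - real k) * \<rho> \<le> real k * (1 + real N * \<rho>)"
    by (simp add: algebra_simps)
  moreover have "0 < 1 + real N * \<rho>" using \<rho> by (simp add: add_pos_nonneg)
  ultimately show ?thesis
    using bd_denom_pos[OF k(2)] by (simp add: bd_down_def field_simps)
qed

text \<open>The out-of-range values do no harm: \<open>g (Suc N)\<close> has coefficient 0, and so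
  has \<open>g (k - 1)\<close> when truncated subtraction turns it into \<open>g 0\<close> at
  \<open>k = 0\<close>.\<close>

lemma sum_bd_jump:
  assumes k: "k \<le> N"
  shows "(\<Sum>j\<in>{0..N}. bd_jump N \<rho> k j * g j) =
    (1 - bd_down N \<rho> k) * g (Suc k) + bd_down N \<rho> k * g (k - 1)"
proof -
  have "(\<Sum>j\<in>{0..N}. bd_jump N \<rho> k j * g j) =
      (\<Sum>j\<in>{0..N}. (if j = Suc k then (1 - bd_down N \<rho> k) * g (Suc k) else 0) +
        (if j = k - 1 then bd_down N \<rho> k * g (k - 1) else 0))"
    using N by (cases "k = 0") (auto simp: bd_jump_def intro!: sum.cong)
  also have "\<dots> = (\<Sum>j\<in>{0..N}. if j = Suc k then (1 - bd_down N \<rho> k) * g (Suc k) else 0) +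
        (\<Sum>j\<in>{0..N}. if j = k - 1 then bd_down N \<rho> k * g (k - 1) else 0)"
    by (rule sum.distrib)
  also have "\<dots> = (1 - bd_down N \<rho> k) * g (Suc k) + bd_down N \<rho> k * g (k - 1)"
    using k by (cases "k = N") auto
  finally show ?thesis .
qed

lemma ruin_term_nonneg: "0 \<le> ruin_term N \<rho> k"
  using \<rho> by (simp add: ruin_term_def)

lemma ruin_sum_0 [simp]: "ruin_sum N \<rho> 0 = 0"
  by (simp add: ruin_sum_def)

lemma ruin_sum_1 [simp]: "ruin_sum N \<rho> (Suc 0) = 1"
  by (simp add: ruin_sum_def ruin_term_def)

lemma ruin_sum_mono: "k \<le> m \<Longrightarrow> ruin_sum N \<rho> k \<le> ruin_sum N \<rho> m"
  unfolding ruin_sum_def by (intro sum_mono2) (auto simp: ruin_term_nonneg)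

lemma ruin_sum_ge_1: "1 \<le> m \<Longrightarrow> 1 \<le> ruin_sum N \<rho> m"
  using ruin_sum_mono[of 1 m] by simp

text \<open>The increments are \<open>ruin_term\<close>, so harmonicity at \<open>k\<close> says
  that up-probability times \<open>ruin_term N \<rho> k\<close> equals down-probability times
  \<open>ruin_term N \<rho> (k - 1)\<close>. This is the absorption identity for binomial
  coefficients.\<close>

lemma ruin_sum_harmonic:
  assumes k: "1 \<le> k" "k < N"
  shows "(1 - bd_down N \<rho> k) * ruin_sum N \<rho> (Suc k) + bd_down N \<rho> k * ruin_sum N \<rho> (k - 1) =
    ruin_sum N \<rho> k"
proof -
  obtain l where l: "k = Suc l" using k by (cases k) auto
  obtain n where n: "N = Suc n" using k by (cases N) auto
  have "real (Suc l) * real (n choose Suc l) = real (n - l) * real (n choose l)"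
    by (metis of_nat_mult Suc_times_choose_Suc)
  then have absorb: "(1 + real l) * real (n choose Suc l) = (real n - real l) * real (n choose l)"
    using k l n by (simp add: of_nat_diff)
  have pos: "0 < real (n choose Suc l)" "0 < real (n choose l)" using k l n by auto
  have den: "0 < 1 + real l + (real n - real l) * \<rho>"
    using bd_denom_pos[of k] k l n by simp
  have ratio: "(real n - real l) / real (n choose Suc l) = (1 + real l) / real (n choose l)"
    using absorb pos by (simp add: frac_eq_eq)
  have "(real n - real l) * \<rho> * ruin_term N \<rho> k =
      ((real n - real l) / real (n choose Suc l)) * (1 / \<rho> ^ l)"
    using \<rho> by (simp add: ruin_term_def n l)
  also have "\<dots> = (1 + real l) * ruin_term N \<rho> l"
    unfolding ratio by (simp add: ruin_term_def n)
  finally have "(real n - real l) * \<rho> * ruin_term N \<rho> k = (1 + real l) * ruin_term N \<rho> l" .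
  then have "(1 - bd_down N \<rho> k) * ruin_term N \<rho> k = bd_down N \<rho> k * ruin_term N \<rho> l"
    using den by (simp add: bd_down_def n l field_simps)
  then show ?thesis
    by (simp add: l ruin_sum_def algebra_simps)
qed

end

locale bd_chain = finite_chain M "{0..N}" "bd_jump N \<rho>" Y
  for M :: "'a measure" and N :: nat and \<rho> :: real and Y :: "nat \<Rightarrow> 'a \<Rightarrow> nat" +
  assumes N: "1 \<le> N" and \<rho>: "0 < \<rho>"
begin

lemma Y_le_N: "\<omega> \<in> space M \<Longrightarrow> Y n \<omega> \<le> N"
  using Y_in_E[of \<omega> n] by simp

lemma AE_leaves_zero: "AE \<omega> in M. \<forall>n. Y n \<omega> = 0 \<longrightarrow> Y (Suc n) \<omega> > 0"
proof -
  have "AE \<omega> in M. \<not> (Y n \<omega> = 0 \<and> Y (Suc n) \<omega> = 0)" for n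
    by (rule AE_transition[where P = "\<lambda>k j. k = 0 \<and> j = 0"]) (auto simp: bd_jump_def)
  then have "AE \<omega> in M. \<forall>n. \<not> (Y n \<omega> = 0 \<and> Y (Suc n) \<omega> = 0)"
    by (simp add: AE_all_countable)
  then show ?thesis by eventually_elim (metis gr0I)
qed

text \<open>
  For small \<open>\<eta>\<close>, \<open>V k = \<eta> + \<dots> + \<eta> ^ k\<close> is a Lyapunov function: its expectation decreases
  geometrically as long as the chain stays positive.
\<close>
lemma prob_no_zero_le:
  "\<exists>C r :: real. 0 \<le> r \<and> r < 1 \<and>
    (\<forall>s n. prob {\<omega> \<in> space M. \<forall>k\<in>{s..s+n}. Y k \<omega> \<noteq> 0} \<le> C * r ^ n)"
proof -
  \<comment> \<open>Half the uniform lower bound on the down-probability: stepping down then loses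
    at least \<open>2 * \<eta> * \<eta> ^ k\<close> on average, stepping up gains at most
    \<open>\<eta> * \<eta> ^ k\<close>, and a net loss of \<open>\<eta> ^ Suc k\<close>
    remains.\<close>
  define \<eta> where "\<eta> = 1 / (1 + real N * \<rho>) / 2"
  define V where "V = (\<lambda>k::nat. \<Sum>j=1..k. \<eta> ^ j)"
  \<comment> \<open>The loss per step is at least \<open>\<eta> ^ Suc N\<close> and \<open>V\<close>
    is at most \<open>N\<close>, so the loss is at least the fraction
    \<open>\<eta> ^ Suc N / N\<close> of \<open>V\<close>.\<close>
  define r where "r = 1 - \<eta> ^ Suc N / N"
  have \<eta>: "0 < \<eta>" "\<eta> \<le> 1"
    using N \<rho> by (auto simp: \<eta>_def field_simps add_pos_nonneg)
  have "\<eta> ^ Suc N \<le> 1" using \<eta> by (intro power_le_one) auto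
  also have "1 \<le> real N" using N by simp
  finally have r: "0 \<le> r" "r < 1" using \<eta> N by (auto simp: r_def)
  have V_le: "V k \<le> N" if "k \<le> N" for k
  proof -
    have "V k \<le> (\<Sum>j=1..k. 1)" unfolding V_def
      using \<eta> by (intro sum_mono power_le_one) auto
    then show ?thesis using that by simp
  qed
  have V_ge: "\<eta> \<le> V k" if "1 \<le> k" for k
  proof -
    have "(\<Sum>j\<in>{1}. \<eta> ^ j) \<le> V k" unfolding V_def
      using \<eta> that by (intro sum_mono2) auto
    then show ?thesis by simp
  qed
  have V_nonneg: "0 \<le> V k" for k unfolding V_def using \<eta> by (intro sum_nonneg) auto
  have drift: "(\<Sum>j\<in>{0..N}. bd_jump N \<rho> k j * V j) \<le> r * V k" if k: "1 \<le> k" "k \<le> N" for k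
  proof -
    let ?d = "bd_down N \<rho> k"
    obtain l where l: "k = Suc l" using k by (cases k) auto
    have "2 * \<eta> = 1 / (1 + real N * \<rho>)" by (simp only: \<eta>_def mult_2 field_sum_of_halves)
    then have d: "2 * \<eta> \<le> ?d" "?d \<le> 1"
      using bd_down_ge[OF N \<rho> k] bd_down_le_1[OF N \<rho> k(2)] by linarith+
    have "(\<Sum>j\<in>{0..N}. bd_jump N \<rho> k j * V j) = (1 - ?d) * V (Suc k) + ?d * V (k - 1)"
      by (rule sum_bd_jump[OF N \<rho> k(2)])
    also have "\<dots> = V k - \<eta> ^ k * (?d - (1 - ?d) * \<eta>)"
      by (simp add: V_def l algebra_simps)
    also have "\<dots> \<le> V k - \<eta> ^ k * \<eta>"
    proof -
      have "(1 - ?d) * \<eta> \<le> 1 * \<eta>" using d \<eta> by (intro mult_right_mono) auto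
      then have "\<eta> \<le> ?d - (1 - ?d) * \<eta>" using d by linarith
      then show ?thesis using \<eta> by (intro diff_left_mono mult_left_mono) auto
    qed
    also have "\<dots> \<le> V k - \<eta> ^ Suc N"
    proof -
      have "\<eta> ^ Suc N \<le> \<eta> ^ Suc k" using k \<eta> by (intro power_decreasing) auto
      then show ?thesis by (simp add: mult.commute)
    qed
    also have "\<dots> \<le> V k - \<eta> ^ Suc N * (V k / N)"
      using V_le[OF k(2)] \<eta> N by (intro diff_left_mono mult_left_le) auto
    also have "\<dots> = r * V k" by (simp add: r_def algebra_simps)
    finally show ?thesis .
  qed
  \<comment> \<open>\<open>V\<close> killed at the first zero from time \<open>s\<close> on. A step
    to 0 needs no correction in the drift because \<open>V 0 = 0\<close>.\<close>
  define W where "W = (\<lambda>s n (y :: nat \<Rightarrow> nat). if \<forall>k\<in>{s..n}. y k \<noteq> 0 then V (y n) else 0)"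
  have W_dep: "depends_upto n (W s n)" for s n
    by (auto simp: depends_upto_def W_def)
  have W_step: "expectation (\<lambda>\<omega>. W s (Suc n) (\<lambda>k. Y k \<omega>)) \<le> r * expectation (\<lambda>\<omega>. W s n (\<lambda>k. Y k \<omega>))"
    if "s \<le> n" for s n
  proof -
    have "expectation (\<lambda>\<omega>. W s (Suc n) (\<lambda>k. Y k \<omega>)) =
        expectation (\<lambda>\<omega>. \<Sum>j\<in>{0..N}. bd_jump N \<rho> (Y n \<omega>) j * W s (Suc n) ((\<lambda>k. Y k \<omega>)(Suc n := j)))"
      by (rule expectation_step[OF W_dep])
    also have "\<dots> \<le> expectation (\<lambda>\<omega>. r * W s n (\<lambda>k. Y k \<omega>))"
    proof (rule integral_mono)
      show "integrable M (\<lambda>\<omega>. \<Sum>j\<in>{0..N}. bd_jump N \<rho> (Y n \<omega>) j *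
          W s (Suc n) ((\<lambda>k. Y k \<omega>)(Suc n := j)))"
        by (rule integrable_step[OF W_dep])
      show "integrable M (\<lambda>\<omega>. r * W s n (\<lambda>k. Y k \<omega>))"
        by (intro integrable_mult_right path_integrable[OF W_dep])
      fix \<omega> assume \<omega>: "\<omega> \<in> space M"
      show "(\<Sum>j\<in>{0..N}. bd_jump N \<rho> (Y n \<omega>) j * W s (Suc n) ((\<lambda>k. Y k \<omega>)(Suc n := j))) \<le>
          r * W s n (\<lambda>k. Y k \<omega>)"
      proof -
        have "{s..Suc n} = insert (Suc n) {s..n}" using that by auto
        then have "(\<forall>k\<in>{s..Suc n}. ((\<lambda>k. Y k \<omega>)(Suc n := j)) k \<noteq> 0) \<longleftrightarrow>
            j \<noteq> 0 \<and> (\<forall>k\<in>{s..n}. Y k \<omega> \<noteq> 0)" for j by simp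
        then have upd: "W s (Suc n) ((\<lambda>k. Y k \<omega>)(Suc n := j)) =
            (if j \<noteq> 0 \<and> (\<forall>k\<in>{s..n}. Y k \<omega> \<noteq> 0) then V j else 0)" for j
          by (simp only: W_def fun_upd_same)
        show ?thesis
        proof (cases "\<forall>k\<in>{s..n}. Y k \<omega> \<noteq> 0")
          case True
          have "W s (Suc n) ((\<lambda>k. Y k \<omega>)(Suc n := j)) = V j" for j
            unfolding upd using True by (auto simp: V_def)
          moreover have "W s n (\<lambda>k. Y k \<omega>) = V (Y n \<omega>)" using True by (simp add: W_def)
          moreover have "1 \<le> Y n \<omega>" using True that by (auto simp: Suc_le_eq)
          ultimately show ?thesis using drift[of "Y n \<omega>"] Y_le_N[OF \<omega>, of n] by simp
        next
          case False
          then have "W s (Suc n) ((\<lambda>k. Y k \<omega>)(Suc n := j)) = 0" for j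
            by (simp only: upd if_False simp_thms)
          moreover have "W s n (\<lambda>k. Y k \<omega>) = 0" using False by (simp only: W_def if_False)
          ultimately show ?thesis by simp
        qed
      qed
    qed
    finally show ?thesis by simp
  qed
  have W_le: "expectation (\<lambda>\<omega>. W s (s + n) (\<lambda>k. Y k \<omega>)) \<le> r ^ n * N" for s n
  proof (induction n)
    case 0
    have "expectation (\<lambda>\<omega>. W s (s + 0) (\<lambda>k. Y k \<omega>)) \<le> expectation (\<lambda>\<omega>. real N)"
    proof (rule integral_mono)
      fix \<omega> assume "\<omega> \<in> space M"
      then show "W s (s + 0) (\<lambda>k. Y k \<omega>) \<le> N" using V_le Y_le_N by (simp add: W_def)
    qed (auto intro: path_integrable[OF W_dep])
    then show ?case by (simp add: prob_space)
  next
    case (Suc n)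
    have "r * expectation (\<lambda>\<omega>. W s (s + n) (\<lambda>k. Y k \<omega>)) \<le> r * (r ^ n * N)"
      using Suc r by (intro mult_left_mono) auto
    then show ?case using W_step[of s "s + n"] by simp
  qed
  \<comment> \<open>As long as the chain is positive \<open>V\<close> is at least
    \<open>\<eta>\<close>, so Markov's inequality produces the constant
    \<open>N / \<eta>\<close>.\<close>
  have "prob {\<omega> \<in> space M. \<forall>k\<in>{s..s+n}. Y k \<omega> \<noteq> 0} \<le> (N / \<eta>) * r ^ n" for s n
  proof -
    let ?A = "{\<omega> \<in> space M. \<forall>k\<in>{s..s+n}. Y k \<omega> \<noteq> 0}"
    have A: "?A \<in> sets M" by measurable
    have "\<eta> * prob ?A = expectation (\<lambda>\<omega>. \<eta> * indicat_real ?A \<omega>)"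
      by (rule expectation_scaled_indicator[OF A, symmetric])
    also have "\<dots> \<le> expectation (\<lambda>\<omega>. W s (s + n) (\<lambda>k. Y k \<omega>))"
    proof (rule integral_mono)
      fix \<omega> assume "\<omega> \<in> space M"
      show "\<eta> * indicat_real ?A \<omega> \<le> W s (s + n) (\<lambda>k. Y k \<omega>)"
        using V_ge[of "Y (s + n) \<omega>"] V_nonneg by (auto simp: W_def indicator_def Suc_le_eq)
    qed (rule integrable_scaled_indicator[OF A] path_integrable[OF W_dep])+
    also have "\<dots> \<le> r ^ n * N" by (rule W_le)
    finally show ?thesis using \<eta> by (simp add: field_simps)
  qed
  then show ?thesis using r by blast
qed

lemma AE_infinitely_many_zeros: "AE \<omega> in M. infinite {k. Y k \<omega> = 0}"
proof -
  obtain C r :: real where r: "0 \<le> r" "r < 1"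
    and C: "\<And>s n. prob {\<omega> \<in> space M. \<forall>k\<in>{s..s+n}. Y k \<omega> \<noteq> 0} \<le> C * r ^ n"
    using prob_no_zero_le by blast
  have "AE \<omega> in M. \<not> (\<forall>k\<ge>s. Y k \<omega> \<noteq> 0)" for s
  proof -
    let ?A = "{\<omega> \<in> space M. \<forall>k\<ge>s. Y k \<omega> \<noteq> 0}"
    have A: "?A \<in> sets M" by measurable
    have "prob ?A \<le> C * r ^ n" for n
    proof -
      have "{\<omega> \<in> space M. \<forall>k\<in>{s..s+n}. Y k \<omega> \<noteq> 0} \<in> sets M" by measurable
      then have "prob ?A \<le> prob {\<omega> \<in> space M. \<forall>k\<in>{s..s+n}. Y k \<omega> \<noteq> 0}"
        by (rule finite_measure_mono[rotated]) auto
      then show ?thesis using C[of s n] by (rule order.trans)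
    qed
    moreover have "(\<lambda>n. C * r ^ n) \<longlonglongrightarrow> C * 0"
      by (intro tendsto_mult tendsto_const LIMSEQ_power_zero) (use r in auto)
    ultimately have "prob ?A \<le> C * 0"
      by (intro LIMSEQ_le_const[where X = "\<lambda>n. C * r ^ n"]) auto
    then have "prob ?A = 0" by (intro antisym) simp_all
    then have "AE \<omega> in M. \<omega> \<notin> ?A" using prob_eq_0[OF A] by blast
    then show ?thesis using AE_space by eventually_elim blast
  qed
  then have "AE \<omega> in M. \<forall>s. \<not> (\<forall>k\<ge>s. Y k \<omega> \<noteq> 0)" by (simp add: AE_all_countable)
  then show ?thesis
    by eventually_elim (auto simp: infinite_nat_iff_unbounded_le)
qed

end

section \<open>Gambler's ruin for an excursion\<close>

lemma zeros_upto_cong: "(\<And>k. k \<le> n \<Longrightarrow> y k = y' k) \<Longrightarrow> zeros_upto y n = zeros_upto y' n"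
  unfolding zeros_upto_def by (intro arg_cong[where f = card]) auto

lemma zeros_upto_0: "zeros_upto y 0 = (if y 0 = 0 then 1 else 0)"
proof -
  have "{k. k \<le> 0 \<and> y k = 0} = (if y 0 = 0 then {0} else {})"
    by (cases "y 0 = 0") (auto intro: gr0I)
  then show ?thesis by (simp add: zeros_upto_def)
qed

lemma zeros_upto_mono: "m \<le> n \<Longrightarrow> zeros_upto y m \<le> zeros_upto y n"
  unfolding zeros_upto_def by (intro card_mono) auto

lemma exc_index_upd [simp]: "exc_index (y(Suc n := j)) i = exc_index y i"
  by (simp add: exc_index_def)

text \<open>For \<open>m >= 1\<close> the inequality already forces \<open>y k\<close> to be
  positive, so the zero opening the block cannot count as reaching \<open>m\<close>.\<close>

definition exc_reaches :: "nat \<Rightarrow> nat \<Rightarrow> (nat \<Rightarrow> nat) \<Rightarrow> bool" where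
  "exc_reaches i m y \<longleftrightarrow> (\<exists>k. zeros_upto y k = exc_index y i \<and> m \<le> y k)"

context bd_chain
begin

text \<open>
  The conditional probability, given the path up to step \<open>n\<close>, that excursion \<open>i\<close> reaches \<open>m\<close>.
  As a process in \<open>n\<close> it is a martingale that converges to the indicator of this event; inside
  the excursion it is the gambler's ruin probability.
\<close>
definition reach_prob :: "nat \<Rightarrow> nat \<Rightarrow> nat \<Rightarrow> (nat \<Rightarrow> nat) \<Rightarrow> real" where
  "reach_prob i m n y =
    (if \<exists>k\<le>n. zeros_upto y k = exc_index y i \<and> m \<le> y k then 1
     else if exc_index y i < zeros_upto y n then 0
     else if zeros_upto y n = exc_index y i \<and> y n > 0 then ruin_sum N \<rho> (y n) / ruin_sum N \<rho> m
     else 1 / ruin_sum N \<rho> m)"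

lemma depends_upto_reach_prob: "depends_upto n (reach_prob i m n)"
  unfolding depends_upto_def
proof (intro allI impI)
  fix y y' :: "nat \<Rightarrow> nat" assume eq: "\<forall>k\<le>n. y k = y' k"
  have "zeros_upto y k = zeros_upto y' k" if "k \<le> n" for k
    using eq that by (intro zeros_upto_cong) auto
  moreover have "exc_index y i = exc_index y' i" using eq by (simp add: exc_index_def)
  ultimately show "reach_prob i m n y = reach_prob i m n y'"
    using eq by (simp add: reach_prob_def cong: conj_cong)
qed

lemma reach_prob_bounds:
  assumes m: "1 \<le> m"
  shows "0 \<le> reach_prob i m n y" "reach_prob i m n y \<le> 1"
proof -
  have S: "1 \<le> ruin_sum N \<rho> m" using ruin_sum_ge_1[OF N \<rho> m] .
  have S0: "0 \<le> ruin_sum N \<rho> k" for k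
    using ruin_sum_mono[OF N \<rho>, of 0 k] ruin_sum_0 N \<rho> by simp
  show "0 \<le> reach_prob i m n y" using S S0 by (simp add: reach_prob_def)
  have "ruin_sum N \<rho> (y n) \<le> ruin_sum N \<rho> m"
    if "\<not> (\<exists>k\<le>n. zeros_upto y k = exc_index y i \<and> m \<le> y k)" "zeros_upto y n = exc_index y i"
    using that by (intro ruin_sum_mono[OF N \<rho>]) (meson le_cases order_refl)
  then show "reach_prob i m n y \<le> 1" using S by (simp add: reach_prob_def)
qed

text \<open>Expresses the next value through the path up to \<open>n\<close> and the new state
  \<open>j\<close> alone: the counter grows by one exactly if \<open>j = 0\<close>, and the earlier
  labels do not change.\<close>

lemma reach_prob_upd:
  "reach_prob i m (Suc n) (y(Suc n := j)) =
    (let r = exc_index y i; c = zeros_upto y n + (if j = 0 then 1 else 0) in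
     if (\<exists>k\<le>n. zeros_upto y k = r \<and> m \<le> y k) \<or> (c = r \<and> m \<le> j) then 1
     else if r < c then 0
     else if c = r \<and> j > 0 then ruin_sum N \<rho> j / ruin_sum N \<rho> m
     else 1 / ruin_sum N \<rho> m)"
proof -
  let ?y = "y(Suc n := j)"
  have z: "zeros_upto ?y k = zeros_upto y k" if "k \<le> n" for k
    using that by (intro zeros_upto_cong) auto
  have zS: "zeros_upto ?y (Suc n) = zeros_upto y n + (if j = 0 then 1 else 0)"
    by (simp add: zeros_upto_Suc z)
  have "(\<exists>k\<le>Suc n. zeros_upto ?y k = exc_index y i \<and> m \<le> ?y k) \<longleftrightarrow>
      (\<exists>k\<le>n. zeros_upto ?y k = exc_index y i \<and> m \<le> ?y k) \<or>
      (zeros_upto ?y (Suc n) = exc_index y i \<and> m \<le> ?y (Suc n))"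
    by (metis le_Suc_eq)
  also have "\<dots> \<longleftrightarrow> (\<exists>k\<le>n. zeros_upto y k = exc_index y i \<and> m \<le> y k) \<or>
      (zeros_upto y n + (if j = 0 then 1 else 0) = exc_index y i \<and> m \<le> j)"
    unfolding zS by (simp add: z cong: conj_cong)
  finally show ?thesis
    unfolding reach_prob_def zS exc_index_upd fun_upd_same Let_def by (simp only:)
qed

text \<open>Inside the excursion this is harmonicity of the scale function. The pieces of the
  definition fit together at their borders: the scale function is 0 at 0 (the excursion has failed),
  its quotient is 1 at \<open>m\<close> (success), and its value 1 at 1 matches the constant used
  before the excursion.\<close>

lemma reach_prob_step:
  assumes m: "1 \<le> m" "m \<le> N" and yn: "y n \<le> N"
  shows "(\<Sum>j\<in>{0..N}. bd_jump N \<rho> (y n) j * reach_prob i m (Suc n) (y(Suc n := j))) =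
    reach_prob i m n y"
proof -
  let ?d = "bd_down N \<rho> (y n)"
  let ?hit = "\<exists>k\<le>n. zeros_upto y k = exc_index y i \<and> m \<le> y k"
  let ?Z = "\<lambda>j. reach_prob i m (Suc n) (y(Suc n := j))"
  have S: "1 \<le> ruin_sum N \<rho> m" using ruin_sum_ge_1[OF N \<rho> m(1)] .
  have "(1 - ?d) * ?Z (Suc (y n)) + ?d * ?Z (y n - 1) = reach_prob i m n y"
  proof (cases ?hit)
    case True
    then have "?Z j = 1" for j unfolding reach_prob_upd Let_def by (simp only: simp_thms if_True)
    moreover have "reach_prob i m n y = 1" using True unfolding reach_prob_def by (simp only: if_True)
    ultimately show ?thesis by simp
  next
    case nohit: False
    consider "exc_index y i < zeros_upto y n" | "zeros_upto y n = exc_index y i" "y n > 0"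
      | "zeros_upto y n = exc_index y i" "y n = 0" | "zeros_upto y n < exc_index y i"
      by linarith
    then show ?thesis
    proof cases
      case 1
      then have "?Z j = 0" for j using nohit by (simp add: reach_prob_upd Let_def)
      moreover have "reach_prob i m n y = 0" using nohit 1 by (auto simp: reach_prob_def)
      ultimately show ?thesis by simp
    next
      case 2
      then have ym: "y n < m" using nohit by (meson not_le order_refl)
      have Z: "?Z j = ruin_sum N \<rho> j / ruin_sum N \<rho> m" if "j \<le> m" for j
        using that nohit 2 S m ruin_sum_0 N \<rho> by (cases "j = m") (auto simp: reach_prob_upd Let_def)
      have "reach_prob i m n y = ruin_sum N \<rho> (y n) / ruin_sum N \<rho> m"
        using 2 nohit by (auto simp: reach_prob_def)
      moreover have "?Z (Suc (y n)) = ruin_sum N \<rho> (Suc (y n)) / ruin_sum N \<rho> m"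
          "?Z (y n - 1) = ruin_sum N \<rho> (y n - 1) / ruin_sum N \<rho> m"
        using ym by (auto intro!: Z)
      ultimately show ?thesis
        using ruin_sum_harmonic[OF N \<rho>, of "y n"] 2 ym m
        by (simp add: add_divide_distrib[symmetric])
    next
      case 3
      have "?Z 1 = 1 / ruin_sum N \<rho> m"
        using 3 nohit ruin_sum_1[OF N \<rho>] m by (cases "m = 1") (auto simp: reach_prob_upd Let_def)
      moreover have "reach_prob i m n y = 1 / ruin_sum N \<rho> m"
        using 3 nohit by (auto simp: reach_prob_def)
      ultimately show ?thesis using 3 bd_down_0[OF N \<rho>] by simp
    next
      case 4
      have "?Z j = 1 / ruin_sum N \<rho> m" for j
        using 4 nohit m by (auto simp: reach_prob_upd Let_def)
      moreover have "reach_prob i m n y = 1 / ruin_sum N \<rho> m"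
        using 4 nohit by (auto simp: reach_prob_def)
      ultimately show ?thesis by (simp add: algebra_simps)
    qed
  qed
  then show ?thesis by (simp add: sum_bd_jump[OF N \<rho> yn])
qed

lemma expectation_reach_prob:
  assumes m: "1 \<le> m" "m \<le> N" and init: "AE \<omega> in M. Y 0 \<omega> \<in> {0, 1}"
  shows "expectation (\<lambda>\<omega>. reach_prob i m n (\<lambda>k. Y k \<omega>)) = 1 / ruin_sum N \<rho> m"
proof (induction n)
  case 0
  \<comment> \<open>A start in 0 or 1 gives the constant: from state 1 with \<open>i = 0\<close> the
    quotient has numerator 1, and if also \<open>m = 1\<close> the level is hit at once and both
    sides are 1.\<close>
  have "expectation (\<lambda>\<omega>. reach_prob i m 0 (\<lambda>k. Y k \<omega>)) = expectation (\<lambda>\<omega>. 1 / ruin_sum N \<rho> m)"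
  proof (rule integral_cong_AE)
    show "AE \<omega> in M. reach_prob i m 0 (\<lambda>k. Y k \<omega>) = 1 / ruin_sum N \<rho> m"
      using init
    proof eventually_elim
      case (elim \<omega>)
      show ?case
        using elim m ruin_sum_1[OF N \<rho>]
        by (cases "m = 1") (auto simp: reach_prob_def exc_index_def zeros_upto_0)
    qed
  qed (auto intro: path_meas[OF depends_upto_reach_prob])
  then show ?case by (simp add: prob_space)
next
  case (Suc n)
  have "expectation (\<lambda>\<omega>. reach_prob i m (Suc n) (\<lambda>k. Y k \<omega>)) =
      expectation (\<lambda>\<omega>. \<Sum>j\<in>{0..N}. bd_jump N \<rho> (Y n \<omega>) j *
        reach_prob i m (Suc n) ((\<lambda>k. Y k \<omega>)(Suc n := j)))"
    by (rule expectation_step[OF depends_upto_reach_prob])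
  also have "\<dots> = expectation (\<lambda>\<omega>. reach_prob i m n (\<lambda>k. Y k \<omega>))"
    using Y_le_N m
    by (intro Bochner_Integration.integral_cong refl reach_prob_step[where y = "\<lambda>k. Y k _"]) auto
  finally show ?case using Suc by simp
qed

lemma exc_reaches_sets: "{\<omega> \<in> space M. exc_reaches i m (\<lambda>k. Y k \<omega>)} \<in> sets M"
proof -
  let ?A = "{\<omega> \<in> space M. exc_reaches i m (\<lambda>k. Y k \<omega>)}"
  have "?A = (\<Union>n. {\<omega> \<in> space M.
      (\<lambda>y. if zeros_upto y n = exc_index y i \<and> m \<le> y n then 1 else 0 :: real) (\<lambda>k. Y k \<omega>) = 1})"
    by (auto simp: exc_reaches_def)
  also have "\<dots> \<in> sets M"
  proof (intro sets.countable_UN image_subsetI)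
    fix n
    let ?f = "\<lambda>y. if zeros_upto y n = exc_index y i \<and> m \<le> y n then 1 else 0 :: real"
    have "depends_upto n ?f"
      unfolding depends_upto_def
    proof (intro allI impI)
      fix y y' :: "nat \<Rightarrow> nat" assume eq: "\<forall>k\<le>n. y k = y' k"
      have "zeros_upto y n = zeros_upto y' n" using eq by (intro zeros_upto_cong) auto
      then show "?f y = ?f y'" using eq by (simp add: exc_index_def)
    qed
    from path_meas[OF this]
    show "{\<omega> \<in> space M. ?f (\<lambda>k. Y k \<omega>) = 1} \<in> sets M" by measurable
  qed
  finally show ?thesis .
qed

text \<open>Every excursion is finite almost surely, so the martingale is eventually equal to the
  indicator of the event; as it is bounded by 1, its constant expectation passes to the limit. The
  value does not involve \<open>i\<close>, which is the identity of the laws of the heights.\<close>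

lemma prob_exc_reaches:
  assumes m: "1 \<le> m" "m \<le> N" and init: "AE \<omega> in M. Y 0 \<omega> \<in> {0, 1}"
  shows "prob {\<omega> \<in> space M. exc_reaches i m (\<lambda>k. Y k \<omega>)} = 1 / ruin_sum N \<rho> m"
proof -
  let ?A = "{\<omega> \<in> space M. exc_reaches i m (\<lambda>k. Y k \<omega>)}"
  have A: "?A \<in> sets M" by (rule exc_reaches_sets)
  have "(\<lambda>n. expectation (\<lambda>\<omega>. reach_prob i m n (\<lambda>k. Y k \<omega>))) \<longlonglongrightarrow>
      expectation (\<lambda>\<omega>. indicat_real ?A \<omega>)"
  proof (rule integral_dominated_convergence[where w = "\<lambda>_. 1"])
    show "AE \<omega> in M. (\<lambda>n. reach_prob i m n (\<lambda>k. Y k \<omega>)) \<longlonglongrightarrow> indicat_real ?A \<omega>"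
      using AE_infinitely_many_zeros AE_space
    proof eventually_elim
      case (elim \<omega>)
      let ?y = "\<lambda>k. Y k \<omega>" and ?r = "exc_index (\<lambda>k. Y k \<omega>) i"
      let ?n = "enumerate {k. Y k \<omega> = 0} ?r"
      \<comment> \<open>\<open>?n\<close> is the zero that closes the excursion; from there on the
        outcome is decided.\<close>
      have "\<forall>\<^sub>F n in sequentially. reach_prob i m n ?y = indicat_real ?A \<omega>"
        using eventually_ge_at_top[of ?n]
      proof eventually_elim
        case (elim n)
        have small: "k < ?n" if "zeros_upto ?y k = ?r" for k
          using that zeros_upto_eq_iff[OF \<open>infinite _\<close>, of k ?r] by simp
        have "zeros_upto ?y n \<noteq> ?r" using small[of n] elim by auto
        moreover have "?r \<le> zeros_upto ?y ?n"
        proof (rule ccontr)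
          assume "\<not> ?r \<le> zeros_upto ?y ?n"
          then have "zeros_upto ?y ?n < ?r" by simp
          moreover have "?n < enumerate {k. Y k \<omega> = 0} (zeros_upto ?y ?n)"
            using zeros_upto_eq_iff[OF \<open>infinite _\<close>, of ?n "zeros_upto ?y ?n"] by simp
          ultimately show False
            using enumerate_mono[OF _ \<open>infinite _\<close>, of "zeros_upto ?y ?n" ?r] by simp
        qed
        ultimately have "?r < zeros_upto ?y n" using zeros_upto_mono[OF elim, of ?y] by linarith
        moreover have "(\<exists>k\<le>n. zeros_upto ?y k = ?r \<and> m \<le> ?y k) \<longleftrightarrow> exc_reaches i m ?y"
          unfolding exc_reaches_def using small elim by (meson less_imp_le order.trans)
        ultimately show ?case
          using \<open>\<omega> \<in> space M\<close> by (simp add: reach_prob_def)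
      qed
      then show ?case by (rule tendsto_eventually)
    qed
    show "AE \<omega> in M. norm (reach_prob i m n (\<lambda>k. Y k \<omega>)) \<le> 1" for n
      using reach_prob_bounds[OF m(1)] by simp
  qed (use A path_meas[OF depends_upto_reach_prob] in auto)
  then have "(\<lambda>n. 1 / ruin_sum N \<rho> m) \<longlonglongrightarrow> prob ?A"
    using A by (simp add: expectation_reach_prob[OF m init])
  then show ?thesis by (simp add: LIMSEQ_const_iff)
qed

end

section \<open>The law of the height\<close>

text \<open>Summing out the last state repeatedly leaves the initial weights. It is used to see that
  the paths with positive holding times carry all the mass.\<close>

lemma sum_path_weights:
  fixes p :: "'s \<Rightarrow> 's \<Rightarrow> real"
  assumes fin: "finite E" and p: "\<And>k. k \<in> E \<Longrightarrow> (\<Sum>j\<in>E. p k j) = 1"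
  shows "(\<Sum>y\<in>{..n} \<rightarrow>\<^sub>E E. w (y 0) * (\<Prod>k<n. p (y k) (y (Suc k)))) = (\<Sum>x\<in>E. w x)"
proof (induction n)
  case 0
  have PiE: "{..0::nat} \<rightarrow>\<^sub>E E = (\<lambda>(y, g). g(0 := y)) ` (E \<times> ({} \<rightarrow>\<^sub>E E))"
    by (simp only: atMost_0 PiE_insert_eq)
  show ?case unfolding PiE
    by (subst sum.reindex)
       (use inj_combinator[of 0 "{}" "\<lambda>_. E"] in \<open>simp_all add: split_beta sum.cartesian_product'\<close>)
next
  case (Suc n)
  have PiE: "{..Suc n} \<rightarrow>\<^sub>E E = (\<lambda>(y, g). g(Suc n := y)) ` (E \<times> ({..n} \<rightarrow>\<^sub>E E))"
    by (simp only: atMost_Suc PiE_insert_eq)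
  have w: "w ((g(Suc n := j)) 0) * (\<Prod>k<Suc n. p ((g(Suc n := j)) k) ((g(Suc n := j)) (Suc k))) =
      w (g 0) * (\<Prod>k<n. p (g k) (g (Suc k))) * p (g n) j" for g :: "nat \<Rightarrow> 's" and j
    by simp
  have "(\<Sum>y\<in>{..Suc n} \<rightarrow>\<^sub>E E. w (y 0) * (\<Prod>k<Suc n. p (y k) (y (Suc k)))) =
      (\<Sum>(j, g)\<in>E \<times> ({..n} \<rightarrow>\<^sub>E E). w (g 0) * (\<Prod>k<n. p (g k) (g (Suc k))) * p (g n) j)"
    unfolding PiE
    by (subst sum.reindex)
       (use inj_combinator[of "Suc n" "{..n}" "\<lambda>_. E"] w in \<open>auto intro!: sum.cong\<close>)
  also have "\<dots> = (\<Sum>j\<in>E. \<Sum>g\<in>{..n} \<rightarrow>\<^sub>E E. w (g 0) * (\<Prod>k<n. p (g k) (g (Suc k))) * p (g n) j)"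
    by (rule sum.cartesian_product[symmetric])
  also have "\<dots> = (\<Sum>g\<in>{..n} \<rightarrow>\<^sub>E E. \<Sum>j\<in>E. w (g 0) * (\<Prod>k<n. p (g k) (g (Suc k))) * p (g n) j)"
    by (rule sum.swap)
  also have "\<dots> = (\<Sum>g\<in>{..n} \<rightarrow>\<^sub>E E. w (g 0) * (\<Prod>k<n. p (g k) (g (Suc k))))"
  proof (rule sum.cong[OF refl])
    fix g assume "g \<in> {..n} \<rightarrow>\<^sub>E E"
    then have "g n \<in> E" by auto
    then show "(\<Sum>j\<in>E. w (g 0) * (\<Prod>k<n. p (g k) (g (Suc k))) * p (g n) j) =
        w (g 0) * (\<Prod>k<n. p (g k) (g (Suc k)))"
      by (simp add: sum_distrib_left[symmetric] p)
  qed
  finally show ?case using Suc by simp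
qed

text \<open>The definition of the chain only gives probabilities in which holding times exceed
  bounds. With all bounds 0 these probabilities sum to 1 over all finite paths, so holding times are
  almost surely positive; the condition on them can then be dropped, which leaves the cylinder law
  of \<open>Y\<close>.\<close>

lemma markov_chain_jump_chain:
  fixes E :: "'s set" and M :: "'a measure"
  assumes fin: "finite E"
    and sum_p: "\<And>k. k \<in> E \<Longrightarrow> (\<Sum>j\<in>E. jump_prob Q k j) = 1"
    and mc: "markov_chain M E Q X"
  shows "\<exists>Y S. finite_chain M E (jump_prob Q) Y \<and> (AE \<omega> in M. \<forall>n. 0 < S n \<omega>) \<and>
    (AE \<omega> in M. \<forall>n t. (\<Sum>k<n. S k \<omega>) \<le> t \<and> t < (\<Sum>k<Suc n. S k \<omega>) \<longrightarrow> X t \<omega> = Y n \<omega>)"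
proof -
  let ?p = "jump_prob Q"
  from mc obtain Y :: "nat \<Rightarrow> 'a \<Rightarrow> 's" and S :: "nat \<Rightarrow> 'a \<Rightarrow> real" where M: "prob_space M"
    and Y: "\<And>n. Y n \<in> measurable M (count_space E)"
    and S [measurable]: "\<And>n. S n \<in> borel_measurable M"
    and law0: "\<And>n y s. (\<forall>k\<le>n. y k \<in> E \<and> 0 \<le> s k) \<longrightarrow>
           measure M {\<omega> \<in> space M. \<forall>k\<le>n. Y k \<omega> = y k \<and> S k \<omega> > s k} =
             measure M {\<omega> \<in> space M. Y 0 \<omega> = y 0} *
             (\<Prod>k<n. ?p (y k) (y (Suc k))) *
             (\<Prod>k\<le>n. exp (- ((- Q (y k) (y k)) * s k)))"
    and X: "AE \<omega> in M. \<forall>n t. (\<Sum>k<n. S k \<omega>) \<le> t \<and> t < (\<Sum>k<Suc n. S k \<omega>) \<longrightarrow> X t \<omega> = Y n \<omega>"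
    unfolding markov_chain_def by blast
  interpret prob_space M by (rule M)
  let ?w = "\<lambda>x. prob {\<omega> \<in> space M. Y 0 \<omega> = x}"
  have Y_E: "Y n \<omega> \<in> E" if "\<omega> \<in> space M" for n \<omega>
    using measurable_space[OF Y that] by simp
  have Y_sets [measurable]: "{\<omega> \<in> space M. Y n \<omega> = y} \<in> sets M" for n y
    by (rule sets_eq_value[OF Y])
  have law: "prob {\<omega> \<in> space M. \<forall>k\<le>n. Y k \<omega> = y k \<and> 0 < S k \<omega>} =
      ?w (y 0) * (\<Prod>k<n. ?p (y k) (y (Suc k)))" if "\<And>k. k \<le> n \<Longrightarrow> y k \<in> E" for n y
    using law0[of n y "\<lambda>_. 0"] that by simp
  have S_pos: "AE \<omega> in M. 0 < S n \<omega>" for n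
  proof -
    let ?A = "\<lambda>y. {\<omega> \<in> space M. \<forall>k\<le>n. Y k \<omega> = y k \<and> 0 < S k \<omega>}"
    have sets: "?A y \<in> sets M" for y by measurable
    have "(\<Sum>y\<in>{..n} \<rightarrow>\<^sub>E E. prob (?A y)) =
        (\<Sum>y\<in>{..n} \<rightarrow>\<^sub>E E. ?w (y 0) * (\<Prod>k<n. ?p (y k) (y (Suc k))))"
    proof (rule sum.cong[OF refl])
      fix y assume y: "y \<in> {..n} \<rightarrow>\<^sub>E E"
      show "prob (?A y) = ?w (y 0) * (\<Prod>k<n. ?p (y k) (y (Suc k)))"
        by (rule law) (use PiE_mem[OF y] in simp)
    qed
    also have "\<dots> = (\<Sum>x\<in>E. ?w x)"
      by (rule sum_path_weights[OF fin sum_p])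
    also have "\<dots> = prob (\<Union>x\<in>E. {\<omega> \<in> space M. Y 0 \<omega> = x})"
      by (rule finite_measure_finite_Union[symmetric])
         (use fin in \<open>auto simp: disjoint_family_on_def\<close>)
    also have "(\<Union>x\<in>E. {\<omega> \<in> space M. Y 0 \<omega> = x}) = space M" using Y_E by auto
    finally have "(\<Sum>y\<in>{..n} \<rightarrow>\<^sub>E E. prob (?A y)) = 1" by (simp add: prob_space)
    moreover have "prob (\<Union>y\<in>{..n} \<rightarrow>\<^sub>E E. ?A y) = (\<Sum>y\<in>{..n} \<rightarrow>\<^sub>E E. prob (?A y))"
    proof (rule finite_measure_finite_Union)
      show "finite ({..n} \<rightarrow>\<^sub>E E)" using fin by (simp add: finite_PiE)
      show "?A ` ({..n} \<rightarrow>\<^sub>E E) \<subseteq> events" using sets by blast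
      show "disjoint_family_on ?A ({..n} \<rightarrow>\<^sub>E E)"
        unfolding disjoint_family_on_def
      proof (intro ballI impI)
        fix y y' assume y: "y \<in> {..n} \<rightarrow>\<^sub>E E" "y' \<in> {..n} \<rightarrow>\<^sub>E E" "y \<noteq> y'"
        then obtain k where "k \<le> n" "y k \<noteq> y' k" using PiE_ext[OF y(1,2)] by auto
        then show "?A y \<inter> ?A y' = {}" by fastforce
      qed
    qed
    ultimately have "prob (\<Union>y\<in>{..n} \<rightarrow>\<^sub>E E. ?A y) = 1" by simp
    then have "AE \<omega> in M. \<omega> \<in> (\<Union>y\<in>{..n} \<rightarrow>\<^sub>E E. ?A y)" by (rule AE_prob_1)
    then show ?thesis by eventually_elim auto
  qed
  then have S_pos': "AE \<omega> in M. \<forall>n. 0 < S n \<omega>" by (simp add: AE_all_countable)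
  have cyl: "prob {\<omega> \<in> space M. \<forall>k\<le>n. Y k \<omega> = y k} = ?w (y 0) * (\<Prod>k<n. ?p (y k) (y (Suc k)))"
    if "\<And>k. k \<le> n \<Longrightarrow> y k \<in> E" for n y
  proof -
    have "prob {\<omega> \<in> space M. \<forall>k\<le>n. Y k \<omega> = y k} =
        prob {\<omega> \<in> space M. \<forall>k\<le>n. Y k \<omega> = y k \<and> 0 < S k \<omega>}"
    proof (rule finite_measure_eq_AE)
      show "AE \<omega> in M. \<omega> \<in> {\<omega> \<in> space M. \<forall>k\<le>n. Y k \<omega> = y k} \<longleftrightarrow>
          \<omega> \<in> {\<omega> \<in> space M. \<forall>k\<le>n. Y k \<omega> = y k \<and> 0 < S k \<omega>}"
        using S_pos' by eventually_elim auto
    qed measurable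
    then show ?thesis using law[OF that] by simp
  qed
  have "finite_chain M E ?p Y"
  proof
    show "finite E" by (rule fin)
    show "Y n \<in> measurable M (count_space E)" for n by (rule Y)
    fix n :: nat and y :: "nat \<Rightarrow> 's" and j
    assume y: "\<And>k. k \<le> n \<Longrightarrow> y k \<in> E" and j: "j \<in> E"
    have "{\<omega> \<in> space M. (\<forall>k\<le>n. Y k \<omega> = y k) \<and> Y (Suc n) \<omega> = j} =
        {\<omega> \<in> space M. \<forall>k\<le>Suc n. Y k \<omega> = (y(Suc n := j)) k}"
      by (auto simp: le_Suc_eq)
    also have "prob \<dots> = ?w (y 0) * (\<Prod>k<n. ?p (y k) (y (Suc k))) * ?p (y n) j"
      by (subst cyl) (use y j in auto)
    also have "\<dots> = prob {\<omega> \<in> space M. \<forall>k\<le>n. Y k \<omega> = y k} * ?p (y n) j"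
      by (subst cyl) (use y in auto)
    finally show "prob {\<omega> \<in> space M. (\<forall>k\<le>n. Y k \<omega> = y k) \<and> Y (Suc n) \<omega> = j} =
        prob {\<omega> \<in> space M. \<forall>k\<le>n. Y k \<omega> = y k} * ?p (y n) j" .
  qed
  then show ?thesis using S_pos' X by blast
qed

lemma finite_chain_cong:
  assumes "finite_chain M E p Y" and eq: "\<And>k j. k \<in> E \<Longrightarrow> j \<in> E \<Longrightarrow> p k j = q k j"
  shows "finite_chain M E q Y"
proof -
  interpret finite_chain M E p Y by fact
  show ?thesis
    by unfold_locales (use finite_E Y_meas transition in \<open>auto simp: eq\<close>)
qed

lemma jump_prob_bd_Q:
  assumes pos: "0 < \<mu>" "0 < \<nu>" and N: "1 \<le> N" and k: "k \<le> N" and j: "j \<le> N"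
  shows "jump_prob (bd_Q \<mu> \<nu> N) k j = bd_jump N (\<nu> / \<mu>) k j"
proof -
  let ?r = "real k * \<mu> + (real N - real k) * \<nu>"
  have "(\<Sum>j\<in>{0..N} - {k}. bd_offdiag \<mu> \<nu> N k j) =
      (\<Sum>j\<in>{0..N} - {k}. (if j = Suc k then (real N - real k) * \<nu> else 0) +
        (if j = k - 1 then real k * \<mu> else 0))"
    using k by (intro sum.cong) (auto simp: bd_offdiag_def)
  also have "\<dots> = (\<Sum>j\<in>{0..N} - {k}. if j = Suc k then (real N - real k) * \<nu> else 0) +
      (\<Sum>j\<in>{0..N} - {k}. if j = k - 1 then real k * \<mu> else 0)"
    by (rule sum.distrib)
  also have "\<dots> = ?r"
    using k by (cases "k = N"; cases "k = 0") auto
  finally have diag: "- bd_Q \<mu> \<nu> N k k = ?r" by (simp add: bd_Q_def)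
  have r: "0 < ?r"
    using pos N k by (cases "k = 0") (auto intro: add_pos_nonneg)
  have "bd_down N (\<nu> / \<mu>) k = real k * \<mu> / ?r"
    using pos r by (simp add: bd_down_def field_simps)
  moreover from this have "1 - bd_down N (\<nu> / \<mu>) k = (real N - real k) * \<nu> / ?r"
    using r by (simp add: field_simps)
  moreover have "jump_prob (bd_Q \<mu> \<nu> N) k j = (if k = j then 0 else bd_offdiag \<mu> \<nu> N k j / ?r)"
    unfolding jump_prob_def diag by (simp add: bd_Q_def)
  ultimately show ?thesis
    using k j by (auto simp: bd_jump_def bd_offdiag_def)
qed

lemma height_law:
  fixes X :: "real \<Rightarrow> 'a \<Rightarrow> nat" and H :: "'a \<Rightarrow> nat"
  assumes pos: "0 < \<mu>" "0 < \<nu>" and N: "1 \<le> N"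
    and mc: "markov_chain M {0..N} (bd_Q \<mu> \<nu> N) X"
    and init: "AE \<omega> in M. X 0 \<omega> \<in> {0, 1}"
    and H: "H \<in> measurable M (count_space UNIV)"
    and height: "AE \<omega> in M. H \<omega> = exc_height (\<lambda>t. X t \<omega>) i"
  shows "AE \<omega> in M. H \<omega> \<le> N"
    and "1 \<le> m \<Longrightarrow> m \<le> N \<Longrightarrow>
      measure M {\<omega> \<in> space M. m \<le> H \<omega>} = 1 / ruin_sum N (\<nu> / \<mu>) m"
proof -
  define \<rho> where "\<rho> = \<nu> / \<mu>"
  have \<rho>: "0 < \<rho>" using pos by (simp add: \<rho>_def)
  have jump: "jump_prob (bd_Q \<mu> \<nu> N) k j = bd_jump N \<rho> k j" if "k \<in> {0..N}" "j \<in> {0..N}" for k j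
    unfolding \<rho>_def using that by (intro jump_prob_bd_Q[OF pos N]) auto
  have sum_p: "(\<Sum>j\<in>{0..N}. jump_prob (bd_Q \<mu> \<nu> N) k j) = 1" if "k \<in> {0..N}" for k
    using sum_bd_jump[OF N \<rho>, of k "\<lambda>_. 1"] that by (simp add: jump)
  obtain Y S where fc: "finite_chain M {0..N} (jump_prob (bd_Q \<mu> \<nu> N)) Y"
    and S: "AE \<omega> in M. \<forall>n. 0 < S n \<omega>"
    and X: "AE \<omega> in M. \<forall>n t. (\<Sum>k<n. S k \<omega>) \<le> t \<and> t < (\<Sum>k<Suc n. S k \<omega>) \<longrightarrow> X t \<omega> = Y n \<omega>"
    using markov_chain_jump_chain[OF _ sum_p mc] by blast
  interpret finite_chain M "{0..N}" "bd_jump N \<rho>" Y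
    by (rule finite_chain_cong[OF fc jump])
  interpret bd_chain M N \<rho> Y
    by unfold_locales (rule N, rule \<rho>)
  have path: "AE \<omega> in M. Y 0 \<omega> = X 0 \<omega> \<and> H \<omega> \<le> N \<and>
      (\<forall>m\<ge>1. m \<le> H \<omega> \<longleftrightarrow> exc_reaches i m (\<lambda>k. Y k \<omega>))"
    using S X AE_infinitely_many_zeros AE_leaves_zero height AE_space
  proof eventually_elim
    case (elim \<omega>)
    let ?T = "\<lambda>n. \<Sum>k<n. S k \<omega>" and ?y = "\<lambda>k. Y k \<omega>"
    let ?A = "{k. ?y k > 0 \<and> zeros_upto ?y k = exc_index ?y i}"
    have T: "strict_mono ?T" "?T 0 = 0" using elim(1) by (simp_all add: strict_mono_Suc_iff)
    note eh = exc_height_eq[OF T elim(2,3,4), of i]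
    have "Y 0 \<omega> = X 0 \<omega>" using elim(1)[rule_format, of 0] elim(2)[rule_format, of 0 0] by simp
    moreover have "H \<omega> \<le> N"
      unfolding elim(5) eh(1) using eh(2,3) Y_le_N[OF elim(6)] by auto
    moreover have "m \<le> H \<omega> \<longleftrightarrow> exc_reaches i m ?y" if "1 \<le> m" for m
    proof -
      have "m \<le> H \<omega> \<longleftrightarrow> (\<exists>k\<in>?A. m \<le> ?y k)"
        unfolding elim(5) eh(1) using eh(2,3) by (subst Max_ge_iff) auto
      also have "\<dots> \<longleftrightarrow> exc_reaches i m ?y"
      proof -
        have "0 < ?y k" if "m \<le> ?y k" for k using that \<open>1 \<le> m\<close> by linarith
        then show ?thesis unfolding exc_reaches_def by blast
      qed
      finally show ?thesis .
    qed
    ultimately show ?case by blast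
  qed
  then show "AE \<omega> in M. H \<omega> \<le> N" by eventually_elim blast
  assume m: "1 \<le> m" "m \<le> N"
  have init': "AE \<omega> in M. Y 0 \<omega> \<in> {0, 1}" using init path by eventually_elim auto
  have "{\<omega> \<in> space M. m \<le> H \<omega>} = H -` {m..} \<inter> space M" by auto
  also have "\<dots> \<in> sets M" by (rule measurable_sets[OF H]) simp
  finally have sets: "{\<omega> \<in> space M. m \<le> H \<omega>} \<in> sets M" .
  have "measure M {\<omega> \<in> space M. m \<le> H \<omega>} = prob {\<omega> \<in> space M. exc_reaches i m (\<lambda>k. Y k \<omega>)}"
  proof (rule finite_measure_eq_AE[OF _ sets exc_reaches_sets])
    show "AE \<omega> in M. \<omega> \<in> {\<omega> \<in> space M. m \<le> H \<omega>} \<longleftrightarrow>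
        \<omega> \<in> {\<omega> \<in> space M. exc_reaches i m (\<lambda>k. Y k \<omega>)}"
      using path by eventually_elim (use m in auto)
  qed
  then show "measure M {\<omega> \<in> space M. m \<le> H \<omega>} = 1 / ruin_sum N (\<nu> / \<mu>) m"
    using prob_exc_reaches[OF m init'] by (simp add: \<rho>_def)
qed

section \<open>Unimodality and entropy bounds for binomial weights\<close>

definition binom_weight :: "nat \<Rightarrow> real \<Rightarrow> nat \<Rightarrow> real" where
  "binom_weight n \<rho> k = real (n choose k) * \<rho> ^ k"

lemma binom_weight_pos: "0 < \<rho> \<Longrightarrow> k \<le> n \<Longrightarrow> 0 < binom_weight n \<rho> k"
  by (simp add: binom_weight_def)

lemma ruin_term_eq: "ruin_term N \<rho> k = 1 / binom_weight (N - 1) \<rho> k"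
  by (simp add: ruin_term_def binom_weight_def)

lemma binom_weight_Suc:
  "k \<le> n \<Longrightarrow> (real k + 1) * binom_weight n \<rho> (Suc k) = (real n - real k) * \<rho> * binom_weight n \<rho> k"
proof -
  assume k: "k \<le> n"
  have "real (Suc k) * real (n choose Suc k) = real (n - k) * real (n choose k)"
    by (metis of_nat_mult Suc_times_choose_Suc)
  then have "(real k + 1) * real (n choose Suc k) = (real n - real k) * real (n choose k)"
    using k by (simp add: of_nat_diff add.commute)
  then show ?thesis by (simp add: binom_weight_def)
qed

lemma binom_weight_le_Suc:
  assumes "0 < \<rho>" "j \<le> n" "real j + 1 \<le> (real n - real j) * \<rho>"
  shows "binom_weight n \<rho> j \<le> binom_weight n \<rho> (Suc j)"
proof -
  have "(real j + 1) * binom_weight n \<rho> j \<le> (real n - real j) * \<rho> * binom_weight n \<rho> j"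
    using assms binom_weight_pos[of \<rho> j n] by (intro mult_right_mono) auto
  then have "(real j + 1) * binom_weight n \<rho> j \<le> (real j + 1) * binom_weight n \<rho> (Suc j)"
    using binom_weight_Suc[of j n \<rho>] assms by simp
  then show ?thesis by (simp add: mult_le_cancel_left_pos)
qed

lemma binom_weight_Suc_le:
  assumes "0 < \<rho>" "j \<le> n" "(real n - real j) * \<rho> \<le> real j + 1"
  shows "binom_weight n \<rho> (Suc j) \<le> binom_weight n \<rho> j"
proof -
  have "(real n - real j) * \<rho> * binom_weight n \<rho> j \<le> (real j + 1) * binom_weight n \<rho> j"
    using assms binom_weight_pos[of \<rho> j n] by (intro mult_right_mono) auto
  then have "(real j + 1) * binom_weight n \<rho> (Suc j) \<le> (real j + 1) * binom_weight n \<rho> j"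
    using binom_weight_Suc[of j n \<rho>] assms by simp
  then show ?thesis by (simp add: mult_le_cancel_left_pos)
qed

text \<open>Unimodality: the ratio of successive weights decreases, so the weights first rise and
  then fall. Either they rise all the way from \<open>a\<close> to \<open>k\<close>, or they fall
  all the way from \<open>k\<close> to \<open>b\<close>.\<close>

lemma min_le_binom_weight:
  assumes \<rho>: "0 < \<rho>" and ab: "a \<le> k" "k \<le> b" "b \<le> n"
  shows "min (binom_weight n \<rho> a) (binom_weight n \<rho> b) \<le> binom_weight n \<rho> k"
proof -
  let ?w = "binom_weight n \<rho>"
  define up where "up = (\<lambda>j. real j + 1 \<le> (real n - real j) * \<rho>)"
  have up_antimono: "up i" if "up j" "i \<le> j" for i j
  proof -
    have "(real n - real j) * \<rho> \<le> (real n - real i) * \<rho>"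
      using that \<rho> by (intro mult_right_mono) auto
    then show ?thesis using that unfolding up_def by linarith
  qed
  show ?thesis
  \<comment> \<open>The case \<open>k = a\<close> is split off so that in the other case
    \<open>k - 1\<close> is a genuine predecessor and at least \<open>a\<close>.\<close>
  proof (cases "k = a \<or> up (k - 1)")
    case True
    have "?w a \<le> ?w k"
      using ab(1)
    proof (induction rule: inc_induct)
      case (step j)
      then have "up j" using True up_antimono[of "k - 1" j] by auto
      then have "?w j \<le> ?w (Suc j)" using step ab \<rho> by (intro binom_weight_le_Suc) (auto simp: up_def)
      then show ?case using step by simp
    qed simp
    then show ?thesis by simp
  next
    case False
    have "?w b \<le> ?w k"
      using ab(2)
    proof (induction rule: dec_induct)
      case (step j)
      then have "\<not> up j" using False up_antimono[of j "k - 1"] by (auto simp: le_diff_conv)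
      then have "?w (Suc j) \<le> ?w j" using step ab \<rho> by (intro binom_weight_Suc_le) (auto simp: up_def)
      then show ?case using step by simp
    qed simp
    then show ?thesis by simp
  qed
qed

text \<open>The logarithm of \<open>x powr x * (1 - x) powr (1 - x) / \<rho> powr x\<close>, divided
  by \<open>x\<close>. The division turns it into an increasing function, whose zero is
  \<open>alpha \<rho>\<close> for \<rho> < 1.\<close>

definition entropy_rate :: "real \<Rightarrow> real \<Rightarrow> real" where
  "entropy_rate \<rho> x = ln x + (1 - x) / x * ln (1 - x) - ln \<rho>"

lemma entropy_rate_deriv:
  assumes "0 < x" "x < 1"
  shows "(entropy_rate \<rho> has_real_derivative - ln (1 - x) / x\<^sup>2) (at x)"
proof -
  have "((\<lambda>x. ln x + (1 - x) / x * ln (1 - x) - ln \<rho>) has_real_derivative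
      1 / x + (((0 - 1) * x - (1 - x) * 1) / (x * x) * ln (1 - x)
        + (0 - 1) / (1 - x) * ((1 - x) / x)) - 0) (at x)"
    using assms
    by (intro DERIV_diff DERIV_add DERIV_mult DERIV_divide DERIV_const DERIV_ident)
       (auto intro!: derivative_eq_intros)
  moreover have "1 / x + (((0 - 1) * x - (1 - x) * 1) / (x * x) * ln (1 - x)
        + (0 - 1) / (1 - x) * ((1 - x) / x)) - 0 = - ln (1 - x) / x\<^sup>2"
    using assms by (simp add: power2_eq_square)
  ultimately show ?thesis by (simp add: entropy_rate_def[abs_def])
qed

text \<open>The slope is at least 1 because \<open>- ln (1 - z) \<ge> z \<ge> z\<^sup>2\<close>.
  Distances from the zero thus become lower bounds for the rate without a Taylor expansion.\<close>

lemma entropy_rate_diff_ge: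
  assumes "0 < x" "x \<le> y" "y < 1"
  shows "y - x \<le> entropy_rate \<rho> y - entropy_rate \<rho> x"
proof -
  have "entropy_rate \<rho> x - x \<le> entropy_rate \<rho> y - y"
  proof (rule DERIV_nonneg_imp_nondecreasing[OF \<open>x \<le> y\<close>, where f = "\<lambda>z. entropy_rate \<rho> z - z"])
    fix z assume "x \<le> z" "z \<le> y"
    with assms have z: "0 < z" "z < 1" by auto
    have "z\<^sup>2 \<le> z" using z by (simp add: power2_eq_square mult_left_le)
    also have "z \<le> - ln (1 - z)" using ln_le_minus_one[of "1 - z"] z by simp
    finally have "1 \<le> - ln (1 - z) / z\<^sup>2" using z by (subst pos_le_divide_eq) auto
    moreover have "((\<lambda>z. entropy_rate \<rho> z - z) has_real_derivative - ln (1 - z) / z\<^sup>2 - 1) (at z)"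
      by (intro DERIV_diff entropy_rate_deriv z DERIV_ident)
    ultimately show "\<exists>d. ((\<lambda>z. entropy_rate \<rho> z - z) has_real_derivative d) (at z) \<and> 0 \<le> d"
      by (intro exI[of _ "- ln (1 - z) / z\<^sup>2 - 1"]) auto
  qed
  then show ?thesis by simp
qed

lemma alpha_props:
  assumes \<rho>: "0 < \<rho>" "\<rho> < 1"
  shows "0 < alpha \<rho>" "alpha \<rho> < 1" "entropy_rate \<rho> (alpha \<rho>) = 0"
proof -
  let ?x = "alpha \<rho>"
  have x: "0 < ?x \<and> ?x < 1 \<and> ?x powr ?x * (1 - ?x) powr (1 - ?x) = \<rho> powr ?x"
    unfolding alpha_def by (rule theI'[OF alpha_ex1[OF \<rho>]])
  then show "0 < ?x" "?x < 1" by auto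
  have "?x powr ?x * (1 - ?x) powr (1 - ?x) = exp (?x * ln ?x + (1 - ?x) * ln (1 - ?x))"
    using x by (simp add: powr_def exp_add)
  moreover have "\<rho> powr ?x = exp (?x * ln \<rho>)"
    using \<rho> by (simp add: powr_def)
  ultimately have "?x * ln ?x + (1 - ?x) * ln (1 - ?x) = ?x * ln \<rho>" using x by simp
  then have "?x * entropy_rate \<rho> ?x = 0"
    using x by (simp add: entropy_rate_def field_simps)
  then show "entropy_rate \<rho> ?x = 0" using x by simp
qed

text \<open>Exponential tilting: multiply and divide by \<open>x ^ k * (1 - x) ^ (n - k)\<close>,
  which exhibits the probability of \<open>k\<close> under the binomial law with mean
  \<open>k\<close>.\<close>

lemma binom_weight_entropy:
  assumes \<rho>: "0 < \<rho>" and k: "0 < k" "k < n"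
  defines "x \<equiv> real k / real n"
  shows "binom_weight n \<rho> k = real (n choose k) * x ^ k * (1 - x) ^ (n - k) * exp (- (real k * entropy_rate \<rho> x))"
proof -
  have x: "0 < x" "x < 1" using k by (auto simp: x_def)
  have kx: "real k * ((1 - x) / x) = real (n - k)"
    using k by (simp add: x_def field_simps of_nat_diff)
  have "real k * entropy_rate \<rho> x = real k * ln x + (real k * ((1 - x) / x)) * ln (1 - x) - real k * ln \<rho>"
    by (simp add: entropy_rate_def algebra_simps)
  also have "\<dots> = ln (x ^ k) + ln ((1 - x) ^ (n - k)) - ln (\<rho> ^ k)"
    using x \<rho> unfolding kx by (simp add: ln_realpow)
  finally have "- (real k * entropy_rate \<rho> x) = ln (\<rho> ^ k) - ln (x ^ k) - ln ((1 - x) ^ (n - k))"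
    by simp
  then have "exp (- (real k * entropy_rate \<rho> x)) = \<rho> ^ k / x ^ k / (1 - x) ^ (n - k)"
    using x \<rho> by (simp add: exp_diff)
  then show ?thesis
    using x by (simp add: binom_weight_def field_simps)
qed

text \<open>
  With \<open>x = k / n\<close>, the index \<open>k\<close> is the mode of the binomial distribution with parameters
  \<open>n\<close> and \<open>x\<close>, so its probability is between \<open>1 / (n + 1)\<close> and \<open>1\<close>.
\<close>
lemma binom_mode:
  assumes k: "0 < k" "k < n"
  defines "x \<equiv> real k / real n"
  shows "real (n choose k) * x ^ k * (1 - x) ^ (n - k) \<le> 1"
    and "1 / (real n + 1) \<le> real (n choose k) * x ^ k * (1 - x) ^ (n - k)"
proof -
  let ?t = "\<lambda>j. real (n choose j) * x ^ j * (1 - x) ^ (n - j)"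
  have x: "0 < x" "x < 1" using k by (auto simp: x_def)
  have total: "(\<Sum>j\<le>n. ?t j) = 1"
    using binomial_ring[of x "1 - x" n] by simp
  have "(\<Sum>j\<in>{k}. ?t j) \<le> (\<Sum>j\<le>n. ?t j)"
    using x k by (intro sum_mono2) auto
  then show "?t k \<le> 1" using total by simp
  \<comment> \<open>The binomial probabilities are, up to a constant, weights whose parameter is the
    odds \<open>x / (1 - x)\<close>, so the comparison of successive weights applies to
    them.\<close>
  have w: "?t j = (1 - x) ^ n * binom_weight n (x / (1 - x)) j" if "j \<le> n" for j
  proof -
    have "(1 - x) ^ n = (1 - x) ^ j * (1 - x) ^ (n - j)"
      using that by (simp add: power_add[symmetric])
    then show ?thesis using x by (simp add: binom_weight_def power_divide)
  qed
  have odds: "x / (1 - x) = real k / (real n - real k)"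
    using k by (simp add: x_def field_simps)
  have "binom_weight n (x / (1 - x)) j \<le> binom_weight n (x / (1 - x)) k" if "j \<le> n" for j
  proof (cases "j \<le> k")
    case True
    then show ?thesis
    proof (induction rule: inc_induct)
      case (step i)
      have "(real i + 1) * real n \<le> real k * real n"
        using step by (intro mult_right_mono) auto
      then have "(real i + 1) * (real n - real k) \<le> (real n - real i) * real k"
        by (simp add: algebra_simps)
      then have "real i + 1 \<le> (real n - real i) * (x / (1 - x))"
        unfolding odds using k by (simp add: pos_le_divide_eq)
      then have "binom_weight n (x / (1 - x)) i \<le> binom_weight n (x / (1 - x)) (Suc i)"
        using step k x by (intro binom_weight_le_Suc) auto
      then show ?case using step by simp
    qed simp
  next
    case False
    then have "k \<le> j" by simp
    then show ?thesis using \<open>j \<le> n\<close>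
    proof (induction rule: dec_induct)
      case (step i)
      have "real k * real n \<le> real i * real n"
        using step by (intro mult_right_mono) auto
      moreover have "(real i + 1) * (real n - real k) - (real n - real i) * real k =
          (real i * real n - real k * real n) + (real n - real k)"
        by (simp add: algebra_simps)
      moreover have "real k \<le> real n" using k by simp
      ultimately have "(real n - real i) * real k \<le> (real i + 1) * (real n - real k)"
        by linarith
      then have "(real n - real i) * (x / (1 - x)) \<le> real i + 1"
        unfolding odds using k by (simp add: pos_divide_le_eq)
      then have "binom_weight n (x / (1 - x)) (Suc i) \<le> binom_weight n (x / (1 - x)) i"
        using step k x by (intro binom_weight_Suc_le) auto
      then show ?case using step by simp
    qed simp
  qed
  then have "?t j \<le> ?t k" if "j \<le> n" for j
    using that k x by (simp add: w mult_left_mono)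
  then have "(\<Sum>j\<le>n. ?t j) \<le> (\<Sum>j\<le>n. ?t k)" by (intro sum_mono) auto
  then have "1 \<le> (real n + 1) * ?t k" using total by (simp add: add.commute)
  then show "1 / (real n + 1) \<le> ?t k" by (simp add: field_simps)
qed

lemma
  assumes \<rho>: "0 < \<rho>" and k: "0 < k" "k < n"
  shows binom_weight_le: "binom_weight n \<rho> k \<le> exp (- (real k * entropy_rate \<rho> (real k / real n)))"
    and binom_weight_ge:
      "exp (- (real k * entropy_rate \<rho> (real k / real n))) / (real n + 1) \<le> binom_weight n \<rho> k"
proof -
  let ?e = "exp (- (real k * entropy_rate \<rho> (real k / real n)))"
  show "binom_weight n \<rho> k \<le> ?e"
    using mult_right_mono[OF binom_mode(1)[OF k], of ?e] by (simp add: binom_weight_entropy[OF assms])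
  show "?e / (real n + 1) \<le> binom_weight n \<rho> k"
    using mult_right_mono[OF binom_mode(2)[OF k], of ?e] by (simp add: binom_weight_entropy[OF assms])
qed

section \<open>Size of the reciprocal weights near 0 and at the edges of the window\<close>

lemma ruin_term_le:
  assumes \<rho>: "0 < \<rho>" and k: "k < N"
  shows "ruin_term N \<rho> k \<le> (real k / ((real N - 1) * \<rho>)) ^ k"
proof -
  have "(real (N - 1) / real k) ^ k \<le> real ((N - 1) choose k)"
    using k by (intro binomial_ge_n_over_k_pow_k) auto
  then have "((real N - 1) / real k) ^ k * \<rho> ^ k \<le> real ((N - 1) choose k) * \<rho> ^ k"
    using k \<rho> by (intro mult_right_mono) (auto simp: of_nat_diff)
  moreover have "0 < ((real N - 1) / real k) ^ k * \<rho> ^ k"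
    using k \<rho> by (cases "k = 0") auto
  ultimately have "ruin_term N \<rho> k \<le> 1 / (((real N - 1) / real k) ^ k * \<rho> ^ k)"
    unfolding ruin_term_def by (intro divide_left_mono) auto
  also have "\<dots> = (real k / ((real N - 1) * \<rho>)) ^ k"
    by (simp add: power_divide power_mult_distrib)
  finally show ?thesis .
qed

text \<open>The bound \<open>g\<close> hides the two regimes: it is exponentially small in
  \<open>sqrt N\<close> for \<rho> < 1 and of order \<open>N\<close> to the power -3 for \<rho> at
  least 1. The factor \<open>(real N)\<^sup>2\<close> leaves room for a sum of up to
  \<open>N\<close> terms and a further factor \<open>N\<close>.\<close>

lemma ruin_term_at_low_end:
  assumes \<rho>: "0 < \<rho>" and \<delta>: "0 < \<delta>"
  defines "m \<equiv> \<lambda>N. nat \<lfloor>height_limit \<rho> * real N - \<delta> * sqrt (real N)\<rfloor>"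
  shows "\<exists>g :: nat \<Rightarrow> real. (\<lambda>N. (real N)\<^sup>2 * g N) \<longlonglongrightarrow> 0 \<and>
    (\<forall>\<^sub>F N in sequentially. 3 \<le> m N \<and> m N < N \<and> ruin_term N \<rho> (m N) \<le> g N)"
proof (cases "\<rho> < 1")
  case True
  define a where "a = alpha \<rho>"
  have a: "0 < a" "a < 1" "entropy_rate \<rho> a = 0"
    using alpha_props[OF \<rho> True] by (auto simp: a_def)
  \<comment> \<open>The product of the two bounds used below: the index is at least
    \<open>a / 2 * N\<close>, and its ratio to \<open>N - 1\<close> stays
    \<open>\<delta> / 2 / sqrt N\<close> below \<open>a\<close>.\<close>
  define d where "d = a * \<delta> / 4"
  have d: "0 < d" using a \<delta> by (simp add: d_def)
  have m: "m N = nat \<lfloor>a * real N - \<delta> * sqrt (real N)\<rfloor>" for N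
    using True by (simp add: m_def height_limit_def a_def)
  have "(\<lambda>N. (real N)\<^sup>2 * (real N * exp (- d * sqrt (real N)))) \<longlonglongrightarrow> 0"
    using d by real_asymp
  moreover have "\<forall>\<^sub>F N in sequentially. 3 \<le> m N \<and> m N < N \<and>
      ruin_term N \<rho> (m N) \<le> real N * exp (- d * sqrt (real N))"
  proof -
    have "\<forall>\<^sub>F N in sequentially. 4 < a * real N - \<delta> * sqrt (real N)"
      using a \<delta> by real_asymp
    moreover have "\<forall>\<^sub>F N in sequentially. a / 2 * real N < a * real N - \<delta> * sqrt (real N) - 1"
      using a \<delta> by real_asymp
    moreover have "\<forall>\<^sub>F N in sequentially. a * real N - \<delta> * sqrt (real N) < real N - 1"
      using a \<delta> by real_asymp
    \<comment> \<open>Dividing by \<open>N - 1\<close> instead of \<open>N\<close> shifts the ratio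
      by order \<open>1 / N\<close>, much less than \<open>\<delta> / sqrt N\<close>; half of the
      gap survives.\<close>
    moreover have "\<forall>\<^sub>F N in sequentially.
        \<delta> / 2 / sqrt (real N) < a - (a * real N - \<delta> * sqrt (real N)) / (real N - 1)"
      using a \<delta> by real_asymp
    ultimately show ?thesis using eventually_gt_at_top[of 1]
    proof eventually_elim
      case (elim N)
      let ?r = "a * real N - \<delta> * sqrt (real N)"
      let ?x = "real (m N) / real (N - 1)"
      have m_le: "real (m N) \<le> ?r" and m_ge: "?r - 1 < real (m N)"
        unfolding m using elim(1) by linarith+
      have m3: "3 \<le> m N" and mN: "m N < N - 1" using m_le m_ge elim by linarith+
      have N1: "real (N - 1) = real N - 1" using elim by (simp add: of_nat_diff)
      have "?x \<le> ?r / (real N - 1)"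
        unfolding N1 using m_le elim by (intro divide_right_mono) auto
      then have gap: "\<delta> / 2 / sqrt (real N) \<le> a - ?x" using elim by linarith
      have "0 < \<delta> / 2 / sqrt (real N)" using \<delta> elim by simp
      then have "0 < a - ?x" using gap by (rule less_le_trans)
      then have xa: "?x < a" by simp
      have x0: "0 < ?x" using m3 mN by simp
      have "d * sqrt (real N) = (a / 2 * real N) * (\<delta> / 2 / sqrt (real N))"
        using elim by (simp add: d_def field_simps real_sqrt_mult_self flip: power2_eq_square)
      also have "\<dots> \<le> real (m N) * (a - ?x)"
        using gap m_ge elim a \<delta> by (intro mult_mono) auto
      also have "\<dots> \<le> real (m N) * - entropy_rate \<rho> ?x"
        using entropy_rate_diff_ge[OF x0 less_imp_le[OF xa] a(2), of \<rho>] a(3)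
        by (intro mult_left_mono) auto
      finally have "exp (d * sqrt (real N)) \<le> exp (- (real (m N) * entropy_rate \<rho> ?x))"
        by simp
      then have "exp (d * sqrt (real N)) / (real (N - 1) + 1) \<le>
          exp (- (real (m N) * entropy_rate \<rho> ?x)) / (real (N - 1) + 1)"
        by (intro divide_right_mono) auto
      also have "\<dots> \<le> binom_weight (N - 1) \<rho> (m N)"
        using m3 mN by (intro binom_weight_ge[OF \<rho>]) auto
      finally have "exp (d * sqrt (real N)) / real N \<le> binom_weight (N - 1) \<rho> (m N)"
        using N1 by simp
      then have "ruin_term N \<rho> (m N) \<le> 1 / (exp (d * sqrt (real N)) / real N)"
        unfolding ruin_term_eq by (intro frac_le) (use elim in auto)
      also have "\<dots> = real N * exp (- d * sqrt (real N))"
        by (simp add: exp_minus field_simps)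
      finally show ?case using m3 mN by simp
    qed
  qed
  ultimately show ?thesis
    by (intro exI[of _ "\<lambda>N. real N * exp (- d * sqrt (real N))"] conjI)
next
  case False
  then have m: "m N = nat \<lfloor>real N - \<delta> * sqrt (real N)\<rfloor>" for N
    by (simp add: m_def height_limit_def)
  have "(\<lambda>N. (real N)\<^sup>2 * (3 / (real N - 1)) ^ 3) \<longlonglongrightarrow> 0" by real_asymp
  moreover have "\<forall>\<^sub>F N in sequentially. 3 \<le> m N \<and> m N < N \<and> ruin_term N \<rho> (m N) \<le> (3 / (real N - 1)) ^ 3"
  proof -
    have "\<forall>\<^sub>F N in sequentially. 4 < real N - \<delta> * sqrt (real N)"
      using \<delta> by real_asymp
    moreover have "\<forall>\<^sub>F N in sequentially. real N - \<delta> * sqrt (real N) < real N - 5"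
      using \<delta> by real_asymp
    ultimately show ?thesis using eventually_gt_at_top[of 10]
    proof eventually_elim
      case (elim N)
      \<comment> \<open>For \<rho> at least 1 the weights dominate those with parameter 1. The
        latter are symmetric about \<open>(N - 1) / 2\<close>, so every index between 3 and
        \<open>N - 1 - 3\<close> has weight at least that of 3.\<close>
      have m3: "3 \<le> m N" and mN: "m N \<le> N - 1 - 3"
        unfolding m using elim by linarith+
      have "(N - 1) choose (N - 1 - 3) = (N - 1) choose 3"
        using elim by (intro binomial_symmetric[symmetric]) auto
      then have "binom_weight (N - 1) 1 3 \<le> binom_weight (N - 1) 1 (m N)"
        using min_le_binom_weight[of 1 3 "m N" "N - 1 - 3" "N - 1"] m3 mN
        by (simp add: binom_weight_def)
      also have "\<dots> \<le> binom_weight (N - 1) \<rho> (m N)"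
        using False unfolding binom_weight_def by (intro mult_left_mono) auto
      finally have "ruin_term N \<rho> (m N) \<le> ruin_term N 1 3"
        unfolding ruin_term_eq using elim m3 mN \<rho>
        by (intro divide_left_mono) (auto intro!: mult_pos_pos binom_weight_pos)
      also have "\<dots> \<le> (3 / (real N - 1)) ^ 3" using ruin_term_le[of 1 3 N] elim by simp
      finally show ?case using m3 mN elim by simp
    qed
  qed
  ultimately show ?thesis
    by (intro exI[of _ "\<lambda>N. (3 / (real N - 1)) ^ 3"] conjI)
qed

text \<open>The index 2 must be treated alone: its term has order \<open>N\<close> to the power -2,
  which is fine once, but as a bound for up to \<open>N\<close> terms it would not survive the
  factor \<open>N\<close>. From index 3 on, a uniform bound suffices.\<close>

lemma low_sum_tendsto:
  assumes \<rho>: "0 < \<rho>" and \<delta>: "0 < \<delta>"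
  shows "(\<lambda>N. real N * (\<Sum>k\<in>{2..nat \<lfloor>height_limit \<rho> * real N - \<delta> * sqrt (real N)\<rfloor>}. ruin_term N \<rho> k)) \<longlonglongrightarrow> 0"
    and "\<forall>\<^sub>F N in sequentially. nat \<lfloor>height_limit \<rho> * real N - \<delta> * sqrt (real N)\<rfloor> < N"
proof -
  define m where "m = (\<lambda>N. nat \<lfloor>height_limit \<rho> * real N - \<delta> * sqrt (real N)\<rfloor>)"
  obtain g :: "nat \<Rightarrow> real" where g: "(\<lambda>N. (real N)\<^sup>2 * g N) \<longlonglongrightarrow> 0"
    and ev: "\<forall>\<^sub>F N in sequentially. 3 \<le> m N \<and> m N < N \<and> ruin_term N \<rho> (m N) \<le> g N"
    using ruin_term_at_low_end[OF assms] unfolding m_def by blast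
  from ev show "\<forall>\<^sub>F N in sequentially. nat \<lfloor>height_limit \<rho> * real N - \<delta> * sqrt (real N)\<rfloor> < N"
    by eventually_elim (simp add: m_def)
  let ?b = "\<lambda>N. real N * (2 / ((real N - 1) * \<rho>))\<^sup>2 + (real N)\<^sup>2 * (3 / ((real N - 1) * \<rho>)) ^ 3"
  have "(\<lambda>N. ?b N + (real N)\<^sup>2 * g N) \<longlonglongrightarrow> 0 + 0"
    by (intro tendsto_add g) (use \<rho> in real_asymp)
  then have lim: "(\<lambda>N. ?b N + (real N)\<^sup>2 * g N) \<longlonglongrightarrow> 0" by simp
  have "(\<lambda>N. real N * (\<Sum>k\<in>{2..m N}. ruin_term N \<rho> k)) \<longlonglongrightarrow> 0"
  proof (rule tendsto_sandwich[OF _ _ tendsto_const lim])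
    show "\<forall>\<^sub>F N in sequentially. 0 \<le> real N * (\<Sum>k\<in>{2..m N}. ruin_term N \<rho> k)"
      using \<rho> by (intro always_eventually allI mult_nonneg_nonneg sum_nonneg) (auto simp: ruin_term_def)
    show "\<forall>\<^sub>F N in sequentially. real N * (\<Sum>k\<in>{2..m N}. ruin_term N \<rho> k) \<le> ?b N + (real N)\<^sup>2 * g N"
      using ev
    proof eventually_elim
      case (elim N)
      then have m: "3 \<le> m N" "m N < N" and gN: "ruin_term N \<rho> (m N) \<le> g N" by auto
      have nonneg: "0 \<le> ruin_term N \<rho> k" for k using \<rho> by (simp add: ruin_term_def)
      \<comment> \<open>By unimodality the term is at most one of the two outer terms; their sum
        stands in for the maximum.\<close>
      have t: "ruin_term N \<rho> k \<le> ruin_term N \<rho> 3 + ruin_term N \<rho> (m N)" if "k \<in> {3..m N}" for k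
      proof -
        let ?w = "binom_weight (N - 1) \<rho>"
        have pos: "0 < ?w 3" "0 < ?w (m N)" "0 < ?w k"
          using that m by (auto intro!: binom_weight_pos[OF \<rho>])
        have "min (?w 3) (?w (m N)) \<le> ?w k"
          using that m by (intro min_le_binom_weight[OF \<rho>]) auto
        then consider "?w 3 \<le> ?w k" | "?w (m N) \<le> ?w k" by linarith
        then have "1 / ?w k \<le> 1 / ?w 3 \<or> 1 / ?w k \<le> 1 / ?w (m N)"
          using pos by cases (simp_all add: frac_le)
        moreover have "0 \<le> 1 / ?w 3" "0 \<le> 1 / ?w (m N)" using pos by simp_all
        ultimately show ?thesis unfolding ruin_term_eq by linarith
      qed
      have "{2..m N} = insert 2 {3..m N}" using m by auto
      then have "(\<Sum>k\<in>{2..m N}. ruin_term N \<rho> k) = ruin_term N \<rho> 2 + (\<Sum>k\<in>{3..m N}. ruin_term N \<rho> k)"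
        by simp
      also have "(\<Sum>k\<in>{3..m N}. ruin_term N \<rho> k) \<le>
          (\<Sum>k\<in>{3..m N}. ruin_term N \<rho> 3 + ruin_term N \<rho> (m N))"
        by (intro sum_mono t)
      also have "\<dots> = real (m N - 2) * (ruin_term N \<rho> 3 + ruin_term N \<rho> (m N))"
        using m by simp
      also have "\<dots> \<le> real N * ((3 / ((real N - 1) * \<rho>)) ^ 3 + g N)"
        using m gN nonneg ruin_term_le[OF \<rho>, of 3 N] by (intro mult_mono add_mono) auto
      also have "ruin_term N \<rho> 2 \<le> (2 / ((real N - 1) * \<rho>))\<^sup>2"
        using ruin_term_le[OF \<rho>, of 2 N] m by simp
      finally have "(\<Sum>k\<in>{2..m N}. ruin_term N \<rho> k) \<le>
          (2 / ((real N - 1) * \<rho>))\<^sup>2 + real N * ((3 / ((real N - 1) * \<rho>)) ^ 3 + g N)"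
        by simp
      then have "real N * (\<Sum>k\<in>{2..m N}. ruin_term N \<rho> k) \<le>
          real N * ((2 / ((real N - 1) * \<rho>))\<^sup>2 + real N * ((3 / ((real N - 1) * \<rho>)) ^ 3 + g N))"
        by (intro mult_left_mono) auto
      also have "\<dots> = ?b N + (real N)\<^sup>2 * g N"
        by (simp add: distrib_left power2_eq_square)
      finally show ?case .
    qed
  qed
  then show "(\<lambda>N. real N * (\<Sum>k\<in>{2..nat \<lfloor>height_limit \<rho> * real N - \<delta> * sqrt (real N)\<rfloor>}. ruin_term N \<rho> k)) \<longlonglongrightarrow> 0"
    by (simp add: m_def)
qed

text \<open>Above \<open>alpha \<rho>\<close> a single weight decides: its reciprocal is one summand
  of the ruin sum and already makes that sum exponentially large in \<open>sqrt N\<close>.\<close>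

lemma high_term_tendsto:
  assumes \<rho>: "0 < \<rho>" "\<rho> < 1" and \<delta>: "0 < \<delta>"
  defines "m \<equiv> \<lambda>N. nat \<lfloor>height_limit \<rho> * real N + \<delta> * sqrt (real N)\<rfloor>"
  shows "(\<lambda>N. real N * (1 / ruin_term N \<rho> (m N))) \<longlonglongrightarrow> 0"
    and "\<forall>\<^sub>F N in sequentially. m N < N"
proof -
  define a where "a = alpha \<rho>"
  have a: "0 < a" "a < 1" "entropy_rate \<rho> a = 0"
    using alpha_props[OF \<rho>] by (auto simp: a_def)
  define d where "d = a * \<delta> / 4"
  have d: "0 < d" using a \<delta> by (simp add: d_def)
  have m: "m N = nat \<lfloor>a * real N + \<delta> * sqrt (real N)\<rfloor>" for N
    using \<rho> by (simp add: m_def height_limit_def a_def)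
  have ev: "\<forall>\<^sub>F N in sequentially. m N < N \<and> 1 / ruin_term N \<rho> (m N) \<le> exp (- d * sqrt (real N))"
  proof -
    have "\<forall>\<^sub>F N in sequentially. a / 2 * real N < a * real N + \<delta> * sqrt (real N) - 1"
      using a \<delta> by real_asymp
    moreover have "\<forall>\<^sub>F N in sequentially. a * real N + \<delta> * sqrt (real N) < real N - 1"
      using a \<delta> by real_asymp
    moreover have "\<forall>\<^sub>F N in sequentially.
        \<delta> / 2 / sqrt (real N) < (a * real N + \<delta> * sqrt (real N) - 1) / real N - a"
      using a \<delta> by real_asymp
    moreover have "\<forall>\<^sub>F N in sequentially. 0 < a / 2 * real N"
      using a by real_asymp
    ultimately show ?thesis using eventually_gt_at_top[of 1]
    proof eventually_elim
      case (elim N)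
      let ?r = "a * real N + \<delta> * sqrt (real N)"
      let ?x = "real (m N) / real (N - 1)"
      have m_le: "real (m N) \<le> ?r" and m_ge: "?r - 1 < real (m N)"
        unfolding m using elim by linarith+
      have m0: "0 < m N" and mN: "m N < N - 1" using m_le m_ge elim by linarith+
      have N1: "real (N - 1) = real N - 1" using elim by (simp add: of_nat_diff)
      \<comment> \<open>Here the passage from \<open>N\<close> to \<open>N - 1\<close> enlarges the
        ratio and so helps; the loss of 1 comes from the floor.\<close>
      have "(?r - 1) / real N \<le> real (m N) / real N"
        using m_ge by (intro divide_right_mono) auto
      also have "\<dots> \<le> ?x"
        unfolding N1 using elim by (intro divide_left_mono) auto
      finally have gap: "\<delta> / 2 / sqrt (real N) \<le> ?x - a" using elim by linarith
      have "0 < \<delta> / 2 / sqrt (real N)" using \<delta> elim by simp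
      then have "0 < ?x - a" using gap by (rule less_le_trans)
      then have xa: "a < ?x" by simp
      have x1: "?x < 1" using mN by simp
      have "d * sqrt (real N) = (a / 2 * real N) * (\<delta> / 2 / sqrt (real N))"
        using elim by (simp add: d_def field_simps real_sqrt_mult_self flip: power2_eq_square)
      also have "\<dots> \<le> real (m N) * (?x - a)"
        using gap m_ge elim a \<delta> by (intro mult_mono) auto
      also have "\<dots> \<le> real (m N) * entropy_rate \<rho> ?x"
        using entropy_rate_diff_ge[OF a(1) less_imp_le[OF xa] x1, of \<rho>] a(3)
        by (intro mult_left_mono) auto
      finally have "exp (- (real (m N) * entropy_rate \<rho> ?x)) \<le> exp (- d * sqrt (real N))"
        by simp
      moreover have "binom_weight (N - 1) \<rho> (m N) \<le> exp (- (real (m N) * entropy_rate \<rho> ?x))"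
        using m0 mN by (intro binom_weight_le[OF \<rho>(1)]) auto
      ultimately have "binom_weight (N - 1) \<rho> (m N) \<le> exp (- d * sqrt (real N))"
        by (rule order.trans[rotated])
      then show ?case using mN by (simp add: ruin_term_eq)
    qed
  qed
  then show "\<forall>\<^sub>F N in sequentially. m N < N" by eventually_elim simp
  have lim: "(\<lambda>N. real N * exp (- d * sqrt (real N))) \<longlonglongrightarrow> 0"
    using d by real_asymp
  show "(\<lambda>N. real N * (1 / ruin_term N \<rho> (m N))) \<longlonglongrightarrow> 0"
  proof (rule tendsto_sandwich[OF _ _ tendsto_const lim])
    show "\<forall>\<^sub>F N in sequentially. 0 \<le> real N * (1 / ruin_term N \<rho> (m N))"
      using \<rho> by (intro always_eventually) (auto simp: ruin_term_def)
    show "\<forall>\<^sub>F N in sequentially. real N * (1 / ruin_term N \<rho> (m N)) \<le> real N * exp (- d * sqrt (real N))"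
      using ev by eventually_elim (intro mult_left_mono, auto)
  qed
qed

section \<open>Moments of the height\<close>

text \<open>The interface between the chain and the asymptotics: only the tail law of the height and
  its range remain. \<open>2 <= N\<close> keeps \<open>N - 1\<close> positive, as the formula for
  the event \<open>H = 1\<close> requires.\<close>

locale ruin_height = prob_space M for M :: "'a measure" +
  fixes N :: nat and \<rho> :: real and H :: "'a \<Rightarrow> nat"
  assumes N: "2 \<le> N" and \<rho>: "0 < \<rho>"
    and H_meas [measurable]: "H \<in> measurable M (count_space UNIV)"
    and H_le: "AE \<omega> in M. H \<omega> \<le> N"
    and H_law: "\<And>m. 1 \<le> m \<Longrightarrow> m \<le> N \<Longrightarrow> prob {\<omega> \<in> space M. m \<le> H \<omega>} = 1 / ruin_sum N \<rho> m"
begin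

lemma H_ge_1: "AE \<omega> in M. 1 \<le> H \<omega>"
proof -
  have "prob {\<omega> \<in> space M. 1 \<le> H \<omega>} = 1"
    using H_law[of 1] N \<rho> by simp
  then have "AE \<omega> in M. \<omega> \<in> {\<omega> \<in> space M. 1 \<le> H \<omega>}" by (rule AE_prob_1)
  then show ?thesis by eventually_elim simp
qed

lemma ruin_sum_ge_1': "1 \<le> m \<Longrightarrow> 1 \<le> ruin_sum N \<rho> m"
  using N \<rho> by (intro ruin_sum_ge_1) auto

lemma prob_between:
  assumes "1 \<le> a" "a \<le> b" "b < N"
  shows "prob {\<omega> \<in> space M. a \<le> H \<omega> \<and> H \<omega> \<le> b} = 1 / ruin_sum N \<rho> a - 1 / ruin_sum N \<rho> (Suc b)"
proof -
  have "{\<omega> \<in> space M. a \<le> H \<omega> \<and> H \<omega> \<le> b} = {\<omega> \<in> space M. a \<le> H \<omega>} - {\<omega> \<in> space M. Suc b \<le> H \<omega>}"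
    by auto
  also have "prob \<dots> = prob {\<omega> \<in> space M. a \<le> H \<omega>} - prob {\<omega> \<in> space M. Suc b \<le> H \<omega>}"
    using assms by (intro finite_measure_Diff) auto
  finally show ?thesis using assms by (simp add: H_law)
qed

lemma prob_eq_1: "prob {\<omega> \<in> space M. H \<omega> = 1} = 1 / ((real N - 1) * \<rho> + 1)"
proof -
  have "{\<omega> \<in> space M. H \<omega> = 1} = {\<omega> \<in> space M. 1 \<le> H \<omega> \<and> H \<omega> \<le> 1}" by auto
  also have "prob \<dots> = 1 - 1 / ruin_sum N \<rho> 2"
    using N \<rho> prob_between[of 1 1] by (simp add: numeral_2_eq_2)
  also have "ruin_sum N \<rho> 2 = 1 + 1 / ((real N - 1) * \<rho>)"
    using N by (simp add: ruin_sum_def ruin_term_def numeral_2_eq_2 of_nat_diff)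
  also have "1 - 1 / (1 + 1 / ((real N - 1) * \<rho>)) = 1 / ((real N - 1) * \<rho> + 1)"
  proof -
    have "1 - 1 / (1 + 1 / z) = 1 / (z + 1)" if "0 < z" for z :: real
      using that by (simp add: field_simps)
    then show ?thesis using N \<rho> by simp
  qed
  finally show ?thesis .
qed

text \<open>Both ruin sums are at least 1, so the difference of their reciprocals is at most the
  difference of the sums.\<close>

lemma prob_low_le:
  assumes "b < N"
  shows "prob {\<omega> \<in> space M. 2 \<le> H \<omega> \<and> H \<omega> \<le> b} \<le> (\<Sum>k\<in>{2..b}. ruin_term N \<rho> k)"
proof (cases "2 \<le> b")
  case True
  let ?S = "ruin_sum N \<rho>"
  have diff: "?S (Suc b) - ?S 2 = (\<Sum>k\<in>{2..b}. ruin_term N \<rho> k)"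
  proof -
    have split: "{..<Suc b} = {..<2} \<union> {2..b}" using True by auto
    show ?thesis
      unfolding ruin_sum_def split by (subst sum.union_disjoint) auto
  qed
  have S: "1 \<le> ?S 2" "?S 2 \<le> ?S (Suc b)"
    using True N \<rho> ruin_sum_ge_1'[of 2] by (auto intro!: ruin_sum_mono)
  have "1 / ?S 2 - 1 / ?S (Suc b) = (?S (Suc b) - ?S 2) / (?S 2 * ?S (Suc b))"
    using S by (simp add: field_simps)
  also have "\<dots> \<le> (?S (Suc b) - ?S 2) / 1"
    using S mult_mono[of 1 "?S 2" 1 "?S (Suc b)"] by (intro divide_left_mono) auto
  finally show ?thesis using prob_between[of 2 b] True assms diff by simp
next
  case False
  then have empty: "{\<omega> \<in> space M. 2 \<le> H \<omega> \<and> H \<omega> \<le> b} = {}" by auto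
  show ?thesis unfolding empty using False by simp
qed

lemma prob_high_le:
  assumes "b < N"
  shows "prob {\<omega> \<in> space M. b < H \<omega>} \<le> 1 / ruin_term N \<rho> b"
proof -
  have term_pos: "0 < ruin_term N \<rho> b" using assms \<rho> by (simp add: ruin_term_def)
  have "ruin_term N \<rho> b \<le> ruin_sum N \<rho> (Suc b)"
    using ruin_sum_mono[of N \<rho> 0 b] N \<rho> ruin_sum_0[of N \<rho>] by (simp add: ruin_sum_def)
  then have "1 / ruin_sum N \<rho> (Suc b) \<le> 1 / ruin_term N \<rho> b"
    using term_pos by (intro divide_left_mono) auto
  then show ?thesis using H_law[of "Suc b"] assms by (simp add: Suc_le_eq)
qed

text \<open>The space is split into \<open>H = 1\<close>, a far part and a near part, where the
  distance from \<open>c\<close> is \<open>\<bar>1 - c\<bar>\<close>, at most \<open>N\<close> and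
  at most \<open>s\<close>. The centre \<open>c\<close> is not the mean, so the variance is
  recovered by subtracting the squared offset.\<close>

lemma moment_bounds:
  fixes c s :: real
  assumes c: "0 \<le> c" "c \<le> real N" and s: "0 \<le> s"
  defines "bad \<equiv> prob {\<omega> \<in> space M. 2 \<le> H \<omega> \<and> s < \<bar>real (H \<omega>) - c\<bar>}"
    and "q \<equiv> 1 / ((real N - 1) * \<rho> + 1)"
  shows "(1 - c)\<^sup>2 * q \<le> expectation (\<lambda>\<omega>. (real (H \<omega>) - c)\<^sup>2)"
    and "expectation (\<lambda>\<omega>. (real (H \<omega>) - c)\<^sup>2) \<le> (1 - c)\<^sup>2 * q + (real N)\<^sup>2 * bad + s\<^sup>2"
    and "\<bar>expectation (\<lambda>\<omega>. real (H \<omega>) - c)\<bar> \<le> \<bar>1 - c\<bar> * q + real N * bad + s"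
    and "variance (\<lambda>\<omega>. real (H \<omega>)) =
      expectation (\<lambda>\<omega>. (real (H \<omega>) - c)\<^sup>2) - (expectation (\<lambda>\<omega>. real (H \<omega>) - c))\<^sup>2"
    and "integrable M (\<lambda>\<omega>. (real (H \<omega>) - c)\<^sup>2)"
proof -
  let ?A = "{\<omega> \<in> space M. H \<omega> = 1}"
  let ?B = "{\<omega> \<in> space M. 2 \<le> H \<omega> \<and> s < \<bar>real (H \<omega>) - c\<bar>}"
  have A: "?A \<in> sets M" and B: "?B \<in> sets M" by measurable
  have int: "integrable M (\<lambda>\<omega>. g (H \<omega>))" for g :: "nat \<Rightarrow> real"
  proof (rule integrable_const_bound[where B = "Max ((\<lambda>k. \<bar>g k\<bar>) ` {..N})"])
    show "AE \<omega> in M. norm (g (H \<omega>)) \<le> Max ((\<lambda>k. \<bar>g k\<bar>) ` {..N})"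
      using H_le by eventually_elim auto
  qed measurable
  show int2: "integrable M (\<lambda>\<omega>. (real (H \<omega>) - c)\<^sup>2)"
    by (rule int[of "\<lambda>k. (real k - c)\<^sup>2"])
  have int1: "integrable M (\<lambda>\<omega>. real (H \<omega>) - c)"
    by (rule int[of "\<lambda>k. real k - c"])
  have intabs: "integrable M (\<lambda>\<omega>. \<bar>real (H \<omega>) - c\<bar>)"
    by (rule int[of "\<lambda>k. \<bar>real k - c\<bar>"])
  note ind = integrable_scaled_indicator expectation_scaled_indicator
  have bound: "integrable M (\<lambda>\<omega>. u * indicat_real ?A \<omega> + v * indicat_real ?B \<omega> + w)"
    "expectation (\<lambda>\<omega>. u * indicat_real ?A \<omega> + v * indicat_real ?B \<omega> + w) = u * q + v * bad + w" for u v w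
  proof -
    have uv: "integrable M (\<lambda>\<omega>. u * indicat_real ?A \<omega> + v * indicat_real ?B \<omega>)"
      by (intro Bochner_Integration.integrable_add ind A B)
    then show "integrable M (\<lambda>\<omega>. u * indicat_real ?A \<omega> + v * indicat_real ?B \<omega> + w)"
      by (rule Bochner_Integration.integrable_add) simp
    have w: "integrable M (\<lambda>_. w)" "expectation (\<lambda>_. w) = w" by (simp_all add: prob_space)
    have "expectation (\<lambda>\<omega>. u * indicat_real ?A \<omega> + v * indicat_real ?B \<omega> + w) =
        expectation (\<lambda>\<omega>. u * indicat_real ?A \<omega> + v * indicat_real ?B \<omega>) + w"
      unfolding Bochner_Integration.integral_add[OF uv w(1)] w(2) ..
    also have "\<dots> = u * q + v * bad + w"
      unfolding Bochner_Integration.integral_add[OF ind(1)[OF A] ind(1)[OF B]] ind(2)[OF A] ind(2)[OF B]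
      by (simp only: prob_eq_1 q_def bad_def)
    finally show "expectation (\<lambda>\<omega>. u * indicat_real ?A \<omega> + v * indicat_real ?B \<omega> + w) =
        u * q + v * bad + w" .
  qed
  have abs_le: "\<bar>real h - c\<bar> \<le> real N" if "h \<le> N" for h
    using that c by (auto simp: abs_le_iff)
  have "(1 - c)\<^sup>2 * q = expectation (\<lambda>\<omega>. (1 - c)\<^sup>2 * indicat_real ?A \<omega>)"
    unfolding ind(2)[OF A] by (simp only: prob_eq_1 q_def)
  also have "\<dots> \<le> expectation (\<lambda>\<omega>. (real (H \<omega>) - c)\<^sup>2)"
    by (intro integral_mono ind(1)[OF A] int2) (simp add: indicator_def)
  finally show "(1 - c)\<^sup>2 * q \<le> expectation (\<lambda>\<omega>. (real (H \<omega>) - c)\<^sup>2)" .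
  have "expectation (\<lambda>\<omega>. (real (H \<omega>) - c)\<^sup>2) \<le>
      expectation (\<lambda>\<omega>. (1 - c)\<^sup>2 * indicat_real ?A \<omega> + (real N)\<^sup>2 * indicat_real ?B \<omega> + s\<^sup>2)"
  proof (rule integral_mono_AE[OF int2 bound(1)])
    show "AE \<omega> in M. (real (H \<omega>) - c)\<^sup>2 \<le>
        (1 - c)\<^sup>2 * indicat_real ?A \<omega> + (real N)\<^sup>2 * indicat_real ?B \<omega> + s\<^sup>2"
      using H_le H_ge_1 AE_space
    proof eventually_elim
      case (elim \<omega>)
      consider "H \<omega> = 1" | "2 \<le> H \<omega>" "s < \<bar>real (H \<omega>) - c\<bar>" | "2 \<le> H \<omega>" "\<bar>real (H \<omega>) - c\<bar> \<le> s"
        using elim by linarith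
      then show ?case
      proof cases
        case 2
        have "\<bar>real (H \<omega>) - c\<bar>\<^sup>2 \<le> (real N)\<^sup>2" using abs_le elim by (intro power_mono) auto
        then show ?thesis using 2 elim by (simp add: add_increasing2)
      next
        case 3
        have "\<bar>real (H \<omega>) - c\<bar>\<^sup>2 \<le> s\<^sup>2" using 3 by (intro power_mono) auto
        then show ?thesis using 3 elim by simp
      qed (use elim in simp)
    qed
  qed
  then show "expectation (\<lambda>\<omega>. (real (H \<omega>) - c)\<^sup>2) \<le> (1 - c)\<^sup>2 * q + (real N)\<^sup>2 * bad + s\<^sup>2"
    unfolding bound(2) .
  have "\<bar>expectation (\<lambda>\<omega>. real (H \<omega>) - c)\<bar> \<le> expectation (\<lambda>\<omega>. \<bar>real (H \<omega>) - c\<bar>)"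
    by (rule integral_abs_bound)
  also have "\<dots> \<le> expectation (\<lambda>\<omega>. \<bar>1 - c\<bar> * indicat_real ?A \<omega> + real N * indicat_real ?B \<omega> + s)"
  proof (rule integral_mono_AE[OF intabs bound(1)])
    show "AE \<omega> in M. \<bar>real (H \<omega>) - c\<bar> \<le> \<bar>1 - c\<bar> * indicat_real ?A \<omega> + real N * indicat_real ?B \<omega> + s"
      using H_le H_ge_1 AE_space
    proof eventually_elim
      case (elim \<omega>)
      consider "H \<omega> = 1" | "2 \<le> H \<omega>" "s < \<bar>real (H \<omega>) - c\<bar>" | "2 \<le> H \<omega>" "\<bar>real (H \<omega>) - c\<bar> \<le> s"
        using elim by linarith
      then show ?case
        using elim s abs_le[of "H \<omega>"] by cases simp_all
    qed
  qed
  finally show "\<bar>expectation (\<lambda>\<omega>. real (H \<omega>) - c)\<bar> \<le> \<bar>1 - c\<bar> * q + real N * bad + s"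
    unfolding bound(2) .
  have "expectation (\<lambda>\<omega>. real (H \<omega>) - c) = expectation (\<lambda>\<omega>. real (H \<omega>)) - c"
    using int[of real] by (simp add: prob_space)
  then have "variance (\<lambda>\<omega>. real (H \<omega>)) = variance (\<lambda>\<omega>. real (H \<omega>) - c)"
    by simp
  also have "\<dots> = expectation (\<lambda>\<omega>. (real (H \<omega>) - c)\<^sup>2) - (expectation (\<lambda>\<omega>. real (H \<omega>) - c))\<^sup>2"
    by (rule variance_eq[OF int1 int2])
  finally show "variance (\<lambda>\<omega>. real (H \<omega>)) =
      expectation (\<lambda>\<omega>. (real (H \<omega>) - c)\<^sup>2) - (expectation (\<lambda>\<omega>. real (H \<omega>) - c))\<^sup>2" .
qed

lemma prob_far_le:
  fixes c s :: real
  assumes "nat \<lfloor>c - s\<rfloor> < N" "nat \<lfloor>c + s\<rfloor> < N"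
  shows "prob {\<omega> \<in> space M. 2 \<le> H \<omega> \<and> s < \<bar>real (H \<omega>) - c\<bar>} \<le>
    (\<Sum>k\<in>{2..nat \<lfloor>c - s\<rfloor>}. ruin_term N \<rho> k) + 1 / ruin_term N \<rho> (nat \<lfloor>c + s\<rfloor>)"
proof -
  let ?L = "{\<omega> \<in> space M. 2 \<le> H \<omega> \<and> H \<omega> \<le> nat \<lfloor>c - s\<rfloor>}"
  let ?U = "{\<omega> \<in> space M. nat \<lfloor>c + s\<rfloor> < H \<omega>}"
  have "h \<le> nat \<lfloor>c - s\<rfloor> \<or> nat \<lfloor>c + s\<rfloor> < h" if "2 \<le> h" "s < \<bar>real h - c\<bar>" for h
    using that by linarith
  then have "prob {\<omega> \<in> space M. 2 \<le> H \<omega> \<and> s < \<bar>real (H \<omega>) - c\<bar>} \<le> prob (?L \<union> ?U)"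
    by (intro finite_measure_mono) auto
  also have "\<dots> \<le> prob ?L + prob ?U" by (rule measure_Un_le) measurable
  finally show ?thesis using prob_low_le[OF assms(1)] prob_high_le[OF assms(2)] by linarith
qed

lemma prob_far_from_top_le:
  fixes s :: real
  assumes "0 \<le> s" "nat \<lfloor>real N - s\<rfloor> < N"
  shows "prob {\<omega> \<in> space M. 2 \<le> H \<omega> \<and> s < \<bar>real (H \<omega>) - real N\<bar>} \<le>
    (\<Sum>k\<in>{2..nat \<lfloor>real N - s\<rfloor>}. ruin_term N \<rho> k)"
proof -
  have "prob {\<omega> \<in> space M. 2 \<le> H \<omega> \<and> s < \<bar>real (H \<omega>) - real N\<bar>} \<le>
      prob {\<omega> \<in> space M. 2 \<le> H \<omega> \<and> H \<omega> \<le> nat \<lfloor>real N - s\<rfloor>}"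
  proof (rule finite_measure_mono_AE)
    show "AE \<omega> in M. \<omega> \<in> {\<omega> \<in> space M. 2 \<le> H \<omega> \<and> s < \<bar>real (H \<omega>) - real N\<bar>} \<longrightarrow>
        \<omega> \<in> {\<omega> \<in> space M. 2 \<le> H \<omega> \<and> H \<omega> \<le> nat \<lfloor>real N - s\<rfloor>}"
      using H_le
    proof eventually_elim
      case (elim \<omega>)
      have "H \<omega> \<le> nat \<lfloor>real N - s\<rfloor>" if "s < \<bar>real (H \<omega>) - real N\<bar>"
        using that elim assms(1) by linarith
      then show ?case by auto
    qed
  qed measurable
  then show ?thesis using prob_low_le[OF assms(2)] by linarith
qed

text \<open>Chebyshev's argument about \<open>c\<close> instead of the mean, so that the second
  moment about \<open>c\<close> can be used directly.\<close>

lemma prob_deviation_le: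
  fixes c t :: real
  assumes c: "0 \<le> c" "c \<le> real N" and t: "0 < t"
  shows "prob {\<omega> \<in> space M. t \<le> \<bar>real (H \<omega>) - c\<bar>} \<le> expectation (\<lambda>\<omega>. (real (H \<omega>) - c)\<^sup>2) / t\<^sup>2"
proof -
  let ?A = "{\<omega> \<in> space M. t \<le> \<bar>real (H \<omega>) - c\<bar>}"
  have A: "?A \<in> sets M" by measurable
  have "t\<^sup>2 * prob ?A = expectation (\<lambda>\<omega>. t\<^sup>2 * indicat_real ?A \<omega>)"
    by (rule expectation_scaled_indicator[OF A, symmetric])
  also have "\<dots> \<le> expectation (\<lambda>\<omega>. (real (H \<omega>) - c)\<^sup>2)"
  proof (rule integral_mono)
    show "integrable M (\<lambda>\<omega>. t\<^sup>2 * indicat_real ?A \<omega>)"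
      by (rule integrable_scaled_indicator[OF A])
    show "integrable M (\<lambda>\<omega>. (real (H \<omega>) - c)\<^sup>2)"
      by (rule moment_bounds(5)[OF c, of 0]) simp
    show "t\<^sup>2 * indicat_real ?A \<omega> \<le> (real (H \<omega>) - c)\<^sup>2" for \<omega>
      using power_mono[of t "\<bar>real (H \<omega>) - c\<bar>" 2] t by (auto simp: indicator_def)
  qed
  finally show ?thesis using t by (simp add: field_simps)
qed

end

section \<open>Asymptotics\<close>

lemma height_limit_bounds:
  assumes "0 < \<rho>"
  shows "0 < height_limit \<rho>" "height_limit \<rho> \<le> 1"
  using assms alpha_props[of \<rho>] by (auto simp: height_limit_def)

text \<open>The factor \<open>real N\<close> is what remains of the squared maximal deviation after
  division by \<open>N\<close>. Both edges matter for \<rho> < 1; for \<rho> at least 1 the centre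
  is \<open>N\<close> itself and only the lower edge does.\<close>

lemma far_prob_tendsto:
  fixes M :: "nat \<Rightarrow> 'a measure" and H :: "nat \<Rightarrow> 'a \<Rightarrow> nat"
  assumes rh: "\<And>N. 2 \<le> N \<Longrightarrow> ruin_height (M N) N \<rho> (H N)" and \<rho>: "0 < \<rho>" and \<delta>: "0 < \<delta>"
  shows "(\<lambda>N. real N * measure (M N) {\<omega> \<in> space (M N).
    2 \<le> H N \<omega> \<and> \<delta> * sqrt (real N) < \<bar>real (H N \<omega>) - height_limit \<rho> * real N\<bar>}) \<longlonglongrightarrow> 0"
    (is "(\<lambda>N. real N * ?bad N) \<longlonglongrightarrow> 0")
proof (cases "\<rho> < 1")
  case True
  let ?lo = "\<lambda>N. nat \<lfloor>height_limit \<rho> * real N - \<delta> * sqrt (real N)\<rfloor>"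
  let ?hi = "\<lambda>N. nat \<lfloor>height_limit \<rho> * real N + \<delta> * sqrt (real N)\<rfloor>"
  have "(\<lambda>N. real N * (\<Sum>k\<in>{2..?lo N}. ruin_term N \<rho> k) + real N * (1 / ruin_term N \<rho> (?hi N))) \<longlonglongrightarrow> 0 + 0"
    by (intro tendsto_add low_sum_tendsto high_term_tendsto \<rho> \<delta> True)
  then have lim: "(\<lambda>N. real N * (\<Sum>k\<in>{2..?lo N}. ruin_term N \<rho> k) +
      real N * (1 / ruin_term N \<rho> (?hi N))) \<longlonglongrightarrow> 0" by simp
  show ?thesis
  proof (rule tendsto_sandwich[OF _ _ tendsto_const lim])
    show "\<forall>\<^sub>F N in sequentially. real N * ?bad N \<le>
        real N * (\<Sum>k\<in>{2..?lo N}. ruin_term N \<rho> k) + real N * (1 / ruin_term N \<rho> (?hi N))"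
      using low_sum_tendsto(2)[OF \<rho> \<delta>] high_term_tendsto(2)[OF \<rho> True \<delta>] eventually_ge_at_top[of 2]
    proof eventually_elim
      case (elim N)
      show ?case
        unfolding distrib_left[symmetric]
        using ruin_height.prob_far_le[OF rh[OF elim(3)] elim(1,2)] by (rule mult_left_mono) simp
    qed
  qed simp
next
  case False
  then have f: "height_limit \<rho> = 1" by (simp add: height_limit_def)
  let ?lo = "\<lambda>N. nat \<lfloor>real N - \<delta> * sqrt (real N)\<rfloor>"
  have lim: "(\<lambda>N. real N * (\<Sum>k\<in>{2..?lo N}. ruin_term N \<rho> k)) \<longlonglongrightarrow> 0"
    using low_sum_tendsto(1)[OF \<rho> \<delta>] by (simp add: f)
  have lo: "\<forall>\<^sub>F N in sequentially. ?lo N < N"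
    using low_sum_tendsto(2)[OF \<rho> \<delta>] by (simp add: f)
  show ?thesis
  proof (rule tendsto_sandwich[OF _ _ tendsto_const lim])
    show "\<forall>\<^sub>F N in sequentially. real N * ?bad N \<le> real N * (\<Sum>k\<in>{2..?lo N}. ruin_term N \<rho> k)"
      using lo eventually_ge_at_top[of 2]
    proof eventually_elim
      case (elim N)
      show ?case
        unfolding f mult_1
        by (intro mult_left_mono ruin_height.prob_far_from_top_le[OF rh[OF elim(2)] _ elim(1)])
           (use \<delta> in auto)
    qed
  qed simp
qed

lemma height_moments_tendsto:
  fixes M :: "nat \<Rightarrow> 'a measure" and H :: "nat \<Rightarrow> 'a \<Rightarrow> nat"
  assumes rh: "\<And>N. 2 \<le> N \<Longrightarrow> ruin_height (M N) N \<rho> (H N)" and \<rho>: "0 < \<rho>"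
  defines "D \<equiv> \<lambda>N \<omega>. real (H N \<omega>) - height_limit \<rho> * real N"
  shows "(\<lambda>N. integral\<^sup>L (M N) (\<lambda>\<omega>. (D N \<omega>)\<^sup>2) / real N) \<longlonglongrightarrow> (height_limit \<rho>)\<^sup>2 / \<rho>"
    and "(\<lambda>N. \<bar>integral\<^sup>L (M N) (D N)\<bar> / sqrt (real N)) \<longlonglongrightarrow> 0"
proof -
  define f where "f = height_limit \<rho>"
  have f: "0 < f" "f \<le> 1" using height_limit_bounds[OF \<rho>] by (auto simp: f_def)
  define bad where "bad = (\<lambda>\<delta> N. measure (M N) {\<omega> \<in> space (M N).
    2 \<le> H N \<omega> \<and> \<delta> * sqrt (real N) < \<bar>real (H N \<omega>) - f * real N\<bar>})"
  have bad: "(\<lambda>N. real N * bad \<delta> N) \<longlonglongrightarrow> 0" if "0 < \<delta>" for \<delta>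
    unfolding bad_def f_def by (rule far_prob_tendsto[OF rh \<rho> that])
  define q where "q = (\<lambda>N. 1 / ((real N - 1) * \<rho> + 1))"
  have c: "0 \<le> f * real N" "f * real N \<le> real N" for N
    using f by (auto simp: mult_left_le_one_le)
  have lower: "(1 - f * real N)\<^sup>2 * q N \<le> integral\<^sup>L (M N) (\<lambda>\<omega>. (D N \<omega>)\<^sup>2)" if "2 \<le> N" for N
    using ruin_height.moment_bounds(1)[OF rh[OF that] c, of 0] by (simp add: D_def q_def f_def)
  have upper: "integral\<^sup>L (M N) (\<lambda>\<omega>. (D N \<omega>)\<^sup>2) \<le>
      (1 - f * real N)\<^sup>2 * q N + (real N)\<^sup>2 * bad \<delta> N + (\<delta> * sqrt (real N))\<^sup>2"
    if "2 \<le> N" "0 < \<delta>" for N \<delta>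
    using ruin_height.moment_bounds(2)[OF rh[OF that(1)] c, of "\<delta> * sqrt (real N)"] that
    by (simp add: D_def q_def f_def bad_def)
  have mean: "\<bar>integral\<^sup>L (M N) (D N)\<bar> \<le>
      \<bar>1 - f * real N\<bar> * q N + real N * bad \<delta> N + \<delta> * sqrt (real N)"
    if "2 \<le> N" "0 < \<delta>" for N \<delta>
    using ruin_height.moment_bounds(3)[OF rh[OF that(1)] c, of "\<delta> * sqrt (real N)"] that
    by (simp add: D_def q_def f_def bad_def)
  \<comment> \<open>The contribution of \<open>H = 1\<close>: its probability is asymptotic to
    \<open>1 / (N * \<rho>)\<close> and its squared deviation to
    \<open>(f * N)\<^sup>2\<close>.\<close>
  have "(\<lambda>N. (1 - f * real N)\<^sup>2 * q N / real N) \<longlonglongrightarrow> f\<^sup>2 * inverse \<rho>"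
    unfolding q_def using f \<rho> by real_asymp
  then have q_lim: "(\<lambda>N. (1 - f * real N)\<^sup>2 * q N / real N) \<longlonglongrightarrow> f\<^sup>2 / \<rho>"
    by (simp add: divide_inverse)
  have "(\<lambda>N. integral\<^sup>L (M N) (\<lambda>\<omega>. (D N \<omega>)\<^sup>2) / real N - (1 - f * real N)\<^sup>2 * q N / real N) \<longlonglongrightarrow> 0"
  proof (rule tendstoI)
    fix e :: real assume e: "0 < e"
    \<comment> \<open>Half of \<open>e\<close> pays for the near part, whose share after division by
      \<open>N\<close> is \<open>\<delta>\<^sup>2\<close>, the other half for the far part.\<close>
    define \<delta> where "\<delta> = sqrt (e / 2)"
    have \<delta>: "0 < \<delta>" "\<delta>\<^sup>2 = e / 2" using e by (auto simp: \<delta>_def)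
    have "\<forall>\<^sub>F N in sequentially. real N * bad \<delta> N < e / 2"
      using order_tendstoD(2)[OF bad[OF \<delta>(1)], of "e / 2"] e by simp
    then show "\<forall>\<^sub>F N in sequentially. dist (integral\<^sup>L (M N) (\<lambda>\<omega>. (D N \<omega>)\<^sup>2) / real N -
        (1 - f * real N)\<^sup>2 * q N / real N) 0 < e"
      using eventually_ge_at_top[of 2]
    proof eventually_elim
      case (elim N)
      have "integral\<^sup>L (M N) (\<lambda>\<omega>. (D N \<omega>)\<^sup>2) / real N \<le>
          ((1 - f * real N)\<^sup>2 * q N + (real N)\<^sup>2 * bad \<delta> N + (\<delta> * sqrt (real N))\<^sup>2) / real N"
        by (intro divide_right_mono upper elim(2) \<delta>(1)) simp
      also have "\<dots> = (1 - f * real N)\<^sup>2 * q N / real N + real N * bad \<delta> N + \<delta>\<^sup>2"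
      proof -
        have "(\<delta> * sqrt (real N))\<^sup>2 = \<delta>\<^sup>2 * real N" by (simp add: power_mult_distrib)
        moreover have "(real N)\<^sup>2 * bad \<delta> N / real N = real N * bad \<delta> N"
          by (simp add: power2_eq_square)
        ultimately show ?thesis using elim(2) by (simp add: add_divide_distrib)
      qed
      finally have "integral\<^sup>L (M N) (\<lambda>\<omega>. (D N \<omega>)\<^sup>2) / real N - (1 - f * real N)\<^sup>2 * q N / real N < e"
        using elim(1) \<delta>(2) by linarith
      moreover have "(1 - f * real N)\<^sup>2 * q N / real N \<le> integral\<^sup>L (M N) (\<lambda>\<omega>. (D N \<omega>)\<^sup>2) / real N"
        by (intro divide_right_mono lower elim(2)) simp
      ultimately show ?case by (simp add: dist_real_def)
    qed
  qed
  from tendsto_add[OF this q_lim]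
  show "(\<lambda>N. integral\<^sup>L (M N) (\<lambda>\<omega>. (D N \<omega>)\<^sup>2) / real N) \<longlonglongrightarrow> (height_limit \<rho>)\<^sup>2 / \<rho>"
    by (simp add: f_def)
  show "(\<lambda>N. \<bar>integral\<^sup>L (M N) (D N)\<bar> / sqrt (real N)) \<longlonglongrightarrow> 0"
  proof (rule tendstoI)
    fix e :: real assume e: "0 < e"
    define \<delta> where "\<delta> = e / 3"
    have \<delta>: "0 < \<delta>" using e by (simp add: \<delta>_def)
    have "(\<lambda>N. (1 + f * real N) * q N / sqrt (real N)) \<longlonglongrightarrow> 0"
      unfolding q_def using f \<rho> by real_asymp
    then have "\<forall>\<^sub>F N in sequentially. (1 + f * real N) * q N / sqrt (real N) < \<delta>"
      using order_tendstoD(2) \<delta> by blast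
    moreover have "\<forall>\<^sub>F N in sequentially. real N * bad \<delta> N < \<delta>"
      using order_tendstoD(2)[OF bad[OF \<delta>] \<delta>] .
    ultimately show "\<forall>\<^sub>F N in sequentially. dist (\<bar>integral\<^sup>L (M N) (D N)\<bar> / sqrt (real N)) 0 < e"
      using eventually_ge_at_top[of 2]
    proof eventually_elim
      case (elim N)
      have sq: "1 \<le> sqrt (real N)" using elim(3) by simp
      have q: "0 \<le> q N" using elim(3) \<rho> by (simp add: q_def)
      have b: "0 \<le> real N * bad \<delta> N" by (simp add: bad_def)
      have "\<bar>integral\<^sup>L (M N) (D N)\<bar> \<le> \<bar>1 - f * real N\<bar> * q N + real N * bad \<delta> N + \<delta> * sqrt (real N)"
        by (rule mean[OF elim(3) \<delta>])
      \<comment> \<open>The far term is multiplied by \<open>sqrt N\<close>, which is at least 1, so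
        that dividing by \<open>sqrt N\<close> leaves exactly the quantity known to tend to
        0.\<close>
      also have "\<dots> \<le> (1 + f * real N) * q N + real N * bad \<delta> N * sqrt (real N) + \<delta> * sqrt (real N)"
        using q c(1)[of N] mult_left_mono[OF sq b]
        by (intro add_mono mult_right_mono) (auto simp: abs_le_iff)
      finally have "\<bar>integral\<^sup>L (M N) (D N)\<bar> / sqrt (real N) \<le>
          ((1 + f * real N) * q N + real N * bad \<delta> N * sqrt (real N) + \<delta> * sqrt (real N)) / sqrt (real N)"
        by (intro divide_right_mono) auto
      also have "\<dots> = (1 + f * real N) * q N / sqrt (real N) + real N * bad \<delta> N + \<delta>"
        using sq by (simp add: add_divide_distrib)
      also have "\<dots> < e" using elim(1,2) \<delta>_def by linarith
      finally show ?case by (simp add: dist_real_def)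
    qed
  qed
qed

theorem theorem1p2:
  fixes \<mu> \<nu> \<rho> :: real
    and M :: "nat \<Rightarrow> 'a measure"
    and X :: "nat \<Rightarrow> real \<Rightarrow> 'a \<Rightarrow> nat"
    and i :: "nat \<Rightarrow> nat"
    and H :: "nat \<Rightarrow> 'a \<Rightarrow> nat"
  assumes "\<mu> > 0" and "\<nu> > 0" and "\<rho> = \<nu> / \<mu>"
    and "\<And>N. N \<ge> 1 \<Longrightarrow> markov_chain (M N) {0..N} (bd_Q \<mu> \<nu> N) (X N)"
    and "\<And>N. N \<ge> 1 \<Longrightarrow> AE \<omega> in M N. X N 0 \<omega> \<in> {0, 1}"
    and "\<And>N. N \<ge> 1 \<Longrightarrow> H N \<in> measurable (M N) (count_space UNIV)"
    and "\<And>N. N \<ge> 1 \<Longrightarrow> AE \<omega> in M N. H N \<omega> = exc_height (\<lambda>t. X N t \<omega>) (i N)"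
  shows "(\<lambda>N. prob_space.variance (M N) (\<lambda>\<omega>. real (H N \<omega>)) / real N)
           \<longlonglongrightarrow> (height_limit \<rho>)\<^sup>2 / \<rho> \<and>
         (\<forall>\<epsilon>>0. (\<lambda>N. measure (M N)
             {\<omega> \<in> space (M N). \<bar>real (H N \<omega>) / real N - height_limit \<rho>\<bar> \<ge> \<epsilon>}) \<longlonglongrightarrow> 0)"
proof -
  let ?f = "height_limit \<rho>"
  let ?D = "\<lambda>N \<omega>. real (H N \<omega>) - ?f * real N"
  have \<rho>: "0 < \<rho>" using assms(1-3) by simp
  have rh: "ruin_height (M N) N \<rho> (H N)" if "2 \<le> N" for N
  proof -
    have N: "1 \<le> N" using that by simp
    note law = height_law[OF assms(1,2) N assms(4-7)[OF N]]
    interpret prob_space "M N"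
      using assms(4)[OF N] by (simp add: markov_chain_def)
    show ?thesis
      by unfold_locales (use that \<rho> assms(3) assms(6)[OF N] law in simp_all)
  qed
  have c: "0 \<le> ?f * real N" "?f * real N \<le> real N" for N
    using height_limit_bounds[OF \<rho>] by (auto simp: mult_left_le_one_le)
  have second: "(\<lambda>N. integral\<^sup>L (M N) (\<lambda>\<omega>. (?D N \<omega>)\<^sup>2) / real N) \<longlonglongrightarrow> ?f\<^sup>2 / \<rho>"
    and mean: "(\<lambda>N. \<bar>integral\<^sup>L (M N) (?D N)\<bar> / sqrt (real N)) \<longlonglongrightarrow> 0"
    using height_moments_tendsto[OF rh \<rho>] by blast+
  \<comment> \<open>The variance over \<open>N\<close> is the second moment about
    \<open>f * N\<close> over \<open>N\<close> minus the square of the offset of the mean over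
    \<open>sqrt N\<close>.\<close>
  have "(\<lambda>N. integral\<^sup>L (M N) (\<lambda>\<omega>. (?D N \<omega>)\<^sup>2) / real N -
      (\<bar>integral\<^sup>L (M N) (?D N)\<bar> / sqrt (real N))\<^sup>2) \<longlonglongrightarrow> ?f\<^sup>2 / \<rho> - 0\<^sup>2"
    by (intro tendsto_diff tendsto_power second mean)
  moreover have "\<forall>\<^sub>F N in sequentially. integral\<^sup>L (M N) (\<lambda>\<omega>. (?D N \<omega>)\<^sup>2) / real N -
      (\<bar>integral\<^sup>L (M N) (?D N)\<bar> / sqrt (real N))\<^sup>2 =
      prob_space.variance (M N) (\<lambda>\<omega>. real (H N \<omega>)) / real N"
    using eventually_ge_at_top[of 2]
  proof eventually_elim
    case (elim N)
    show ?case
      unfolding ruin_height.moment_bounds(4)[OF rh[OF elim] c order.refl]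
      by (simp add: power_divide diff_divide_distrib)
  qed
  ultimately have variance: "(\<lambda>N. prob_space.variance (M N) (\<lambda>\<omega>. real (H N \<omega>)) / real N)
      \<longlonglongrightarrow> ?f\<^sup>2 / \<rho>"
    by (auto dest: Lim_transform_eventually)
  have "(\<lambda>N. measure (M N) {\<omega> \<in> space (M N). \<bar>real (H N \<omega>) / real N - ?f\<bar> \<ge> \<epsilon>}) \<longlonglongrightarrow> 0"
    if \<epsilon>: "0 < \<epsilon>" for \<epsilon> :: real
  proof -
    \<comment> \<open>Chebyshev's bound is the second moment over
      \<open>(\<epsilon> * N)\<^sup>2\<close>; the second moment is only of order \<open>N\<close>,
      so one factor \<open>1 / N\<close> is left over.\<close>
    have "(\<lambda>N. 1 / (\<epsilon>\<^sup>2 * real N)) \<longlonglongrightarrow> 0"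
      using \<epsilon> by real_asymp
    from tendsto_mult[OF second this]
    have "(\<lambda>N. (integral\<^sup>L (M N) (\<lambda>\<omega>. (?D N \<omega>)\<^sup>2) / real N) * (1 / (\<epsilon>\<^sup>2 * real N))) \<longlonglongrightarrow> ?f\<^sup>2 / \<rho> * 0"
      by simp
    then have lim: "(\<lambda>N. (integral\<^sup>L (M N) (\<lambda>\<omega>. (?D N \<omega>)\<^sup>2) / real N) * (1 / (\<epsilon>\<^sup>2 * real N))) \<longlonglongrightarrow> 0"
      by simp
    show ?thesis
    proof (rule tendsto_sandwich[OF _ _ tendsto_const lim])
      show "\<forall>\<^sub>F N in sequentially. measure (M N)
          {\<omega> \<in> space (M N). \<bar>real (H N \<omega>) / real N - ?f\<bar> \<ge> \<epsilon>} \<le>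
          (integral\<^sup>L (M N) (\<lambda>\<omega>. (?D N \<omega>)\<^sup>2) / real N) * (1 / (\<epsilon>\<^sup>2 * real N))"
        using eventually_ge_at_top[of 2]
      proof eventually_elim
        case (elim N)
        have "\<epsilon> \<le> \<bar>real h / real N - ?f\<bar> \<longleftrightarrow> \<epsilon> * real N \<le> \<bar>real h - ?f * real N\<bar>" for h
        proof -
          have "\<bar>real h - ?f * real N\<bar> = \<bar>(real h / real N - ?f) * real N\<bar>"
            using elim by (simp add: left_diff_distrib)
          also have "\<dots> = \<bar>real h / real N - ?f\<bar> * real N" by (simp add: abs_mult)
          finally show ?thesis using elim by simp
        qed
        then have "measure (M N) {\<omega> \<in> space (M N). \<bar>real (H N \<omega>) / real N - ?f\<bar> \<ge> \<epsilon>} =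
            measure (M N) {\<omega> \<in> space (M N). \<epsilon> * real N \<le> \<bar>?D N \<omega>\<bar>}" by simp
        also have "\<dots> \<le> integral\<^sup>L (M N) (\<lambda>\<omega>. (?D N \<omega>)\<^sup>2) / (\<epsilon> * real N)\<^sup>2"
          by (rule ruin_height.prob_deviation_le[OF rh[OF elim] c]) (use \<epsilon> elim in simp)
        finally show ?case by (simp add: power2_eq_square field_simps)
      qed
    qed simp
  qed
  then show ?thesis using variance by blast
qed

end
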